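(* Let $A=\sum_{s=1}^p\sum_{g\in G}g\cdot\big(f_s\phi_{\xi^{a_s}_{i_s}}\big)\in\mathcal S(V)^G$, where $f_s$ are meromorphic (or rational) functions on $V$, $a_s\in\mathbb C$ and $i_s\in\{1,\dots,n\}$. Assume that $A$ preserves the vector space $\mathfrak O^G$. Then $A$ is a generator of a rational Galois order, i.e. there exists a character $\chi:G\to\mathbb C^\times$ such that $d_\chi A$ is holomorphic in $V$.
   Context: Fix $n\ge 2$ and positive integers $n_1,\dots,n_n$. $V=\mathbb C^{\sum_k n_k}=\{v=(v_{ki}) : 1\le k\le n,\ 1\le i\le n_k\}$, an additive group, and $G=S_{n_1}\times\cdots\times S_{n_n}$ acts on $V$ by permuting, for each $k$, the coordinates $v_{k1},\dots,v_{kn_k}$. $\delta^{k1}\in V$ is the vector with entry $1$ in position $(k,1)$ and $0$ elsewhere; for $a\in\mathbb C$, $\xi^a_k=a\delta^{k1}$. $\mathcal O$ and $\mathcal M$ are the sheaves of holomorphic (or polynomial) and meromorphic (or rational) functions on $V$, with germs $\mathcal O_x,\mathcal M_x$. $\phi_\xi$ is translation $x\mapsto x+\xi$, acting on functions/germs by $\phi_\xi(f)(x)=f(x-\xi)$. $\mathcal S(V)$ is the skew-group ring of finite sums $\sum_i f_i\phi_{\xi_i}$, $f_i$ meromorphic (or rational) on $V$, $\xi_i\in V$, with product $f\phi_\xi\circ f'\phi_{\xi'}=f\phi_\xi(f')\phi_{\xi+\xi'}$; it acts on $\bigoplus_x\mathcal M_x$ by $f\phi_\xi:\mathcal M_x\to\mathcal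 M_{x+\xi}$, $F\mapsto f\phi_\xi(F)$. $G$ acts by $(g\cdot f)(x)=f(g^{-1}\cdot x)$ and $g\cdot(f\phi_\xi)=(g\cdot f)\phi_{g\cdot\xi}$; $\mathcal S(V)^G$ is the ring of invariants. $\mathfrak O^G=\bigoplus_{\bar x\in V/G}\mathcal O^G_{\bar x}$ with $\mathcal O^G_{\bar x}=\big(\bigoplus_{x'\in\bar x}\mathcal O_{x'}\big)^G$; $A$ preserves $\mathfrak O^G$ if $A(\mathfrak O^G)\subset\mathfrak O^G$. For a character $\chi:G\to\mathbb C^\times$, $d_\chi=\prod_{H}\gamma_H^{a_H}$, the product over all hyperplanes $H\subset V$ fixed by a reflection $\sigma_H\in G$, where $\gamma_H\in V^*$ has kernel $H$ and $a_H$ is the minimal non-negative integer with $\chi(\sigma_H)=\det(\sigma_H^* )^{a_H}$ (so $a_H\in\{0,1\}$). An element $X=\sum_i f_i\phi_{\xi_i}$ (distinct $\xi_i$) has $d_\chi X$ holomorphic in $V$ if all $d_\chi f_i$ are holomorphic on $V$. A rational Galois order is a subalgebra of $\mathcal S(V)^G$ that contains the algebra $H^0(V,\mathcal O^G)$ of global $G$-invariant functions and is generated (over it) by finitely many elements $X\in\mathcal S(V)^G$ such that for each of them there is a character $\chi$ of $G$ with $d_\chi X$ holomorphic in $V$; these elements $X$ are called its generators. *)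

theory Defs
  imports
    "HOL-Analysis.Analysis"
    "HOL-Algebra.Product_Groups"
    "HOL-Algebra.Sym_Groups"
begin

section \<open>The space \<open>V\<close> and the group \<open>G\<close>\<close>

text \<open>
  \<open>V\<close> is \<open>complex ^ 'i\<close>, where \<open>pos\<close> identifies the positions \<open>(k, i)\<close>, \<open>1 \<le> k \<le> n\<close>,
  \<open>1 \<le> i \<le> m k\<close>, with the index type: \<open>bij_betw pos (positions n m) UNIV\<close>.  The coordinate
  \<open>v\<^sub>k\<^sub>i\<close> is \<open>v $ pos (k, i)\<close>; the numbers \<open>n\<^sub>k\<close> are written \<open>m k\<close>.
\<close>

definition positions :: "nat \<Rightarrow> (nat \<Rightarrow> nat) \<Rightarrow> (nat \<times> nat) set" where
  "positions n m = (SIGMA k:{1..n}. {1..m k})"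

definition perm_group :: "nat \<Rightarrow> (nat \<Rightarrow> nat) \<Rightarrow> (nat \<Rightarrow> nat \<Rightarrow> nat) monoid" where
  "perm_group n m = product_group {1..n} (\<lambda>k. sym_group (m k))"

text \<open>\<open>(g \<cdot> v)\<^sub>k\<^sub>i = v\<^sub>k\<^sub>j\<close> with \<open>j = g\<^sub>k\<^sup>-\<^sup>1(i)\<close>, a left action sending \<open>\<delta>\<^sup>k\<^sup>i\<close> to \<open>\<delta>\<^sup>k\<^sup>j\<close> with
  \<open>j = g\<^sub>k(i)\<close>.\<close>

definition act ::
  "nat \<Rightarrow> (nat \<Rightarrow> nat) \<Rightarrow> (nat \<times> nat \<Rightarrow> 'i::finite) \<Rightarrow> (nat \<Rightarrow> nat \<Rightarrow> nat) \<Rightarrow>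
    complex ^ 'i \<Rightarrow> complex ^ 'i" where
  "act n m pos g v =
    (\<chi> q. case inv_into (positions n m) pos q of (k, i) \<Rightarrow> v $ pos (k, Hilbert_Choice.inv (g k) i))"

definition act_fun ::
  "nat \<Rightarrow> (nat \<Rightarrow> nat) \<Rightarrow> (nat \<times> nat \<Rightarrow> 'i::finite) \<Rightarrow> (nat \<Rightarrow> nat \<Rightarrow> nat) \<Rightarrow>
    (complex ^ 'i \<Rightarrow> complex) \<Rightarrow> complex ^ 'i \<Rightarrow> complex" where
  "act_fun n m pos g f x = f (act n m pos (inv\<^bsub>perm_group n m\<^esub> g) x)"

definition xi :: "(nat \<times> nat \<Rightarrow> 'i::finite) \<Rightarrow> nat \<Rightarrow> complex \<Rightarrow> complex ^ 'i" where
  "xi pos k a = axis (pos (k, 1)) a"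


section \<open>Holomorphic and polynomial functions, germs, meromorphic and rational functions\<close>

definition holomorphic_on_open :: "(complex ^ 'i::finite) set \<Rightarrow> (complex ^ 'i \<Rightarrow> complex) \<Rightarrow> bool" where
  "holomorphic_on_open U f \<longleftrightarrow> open U \<and>
    (\<forall>x\<in>U. \<exists>D. (f has_derivative D) (at x) \<and> Vector_Spaces.linear (*s) (*) D)"

inductive poly_fun :: "(complex ^ 'i::finite \<Rightarrow> complex) \<Rightarrow> bool" where
  const: "poly_fun (\<lambda>_. c)"
| coord: "poly_fun (\<lambda>v. v $ q)"
| add: "poly_fun f \<Longrightarrow> poly_fun g \<Longrightarrow> poly_fun (\<lambda>v. f v + g v)"
| mult: "poly_fun f \<Longrightarrow> poly_fun g \<Longrightarrow> poly_fun (\<lambda>v. f v * g v)"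

text \<open>
  \<open>Analytic\<close>: \<open>\<O>\<close> and \<open>\<M>\<close> are the sheaves of holomorphic and meromorphic functions;
  \<open>Algebraic\<close>: they are the sheaves of regular (polynomial) and rational functions.
\<close>

datatype geometry = Analytic | Algebraic

text \<open>
  Germs at \<open>x\<close> are represented by functions on \<open>V\<close> of which only the behaviour near \<open>x\<close> matters.
  In the algebraic case the stalk is the local ring of fractions with denominator
  nonvanishing at \<open>x\<close>.
\<close>

fun stalk :: "geometry \<Rightarrow> complex ^ 'i::finite \<Rightarrow> (complex ^ 'i \<Rightarrow> complex) set" where
  "stalk Analytic x = {f. \<exists>U. x \<in> U \<and> holomorphic_on_open U f}"
| "stalk Algebraic x = {f. \<exists>p q. poly_fun p \<and> poly_fun q \<and> q x \<noteq> 0 \<and>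
      (\<forall>\<^sub>F z in nhds x. f z = p z / q z)}"

text \<open>
  Equality in \<open>\<M>\<^sub>x\<close>: agreement on a dense open part of a neighbourhood of \<open>x\<close>.  The values of a
  representative on the zero set of a denominator are thus irrelevant (so \<open>p z / 0 = 0\<close>
  does no harm); for members of \<open>stalk S x\<close>, which are continuous near \<open>x\<close>, this is equality of
  germs in the usual sense.
\<close>

definition germ_eq ::
  "complex ^ 'i::finite \<Rightarrow> (complex ^ 'i \<Rightarrow> complex) \<Rightarrow> (complex ^ 'i \<Rightarrow> complex) \<Rightarrow> bool" where
  "germ_eq x f g \<longleftrightarrow>
    (\<exists>U W. open U \<and> x \<in> U \<and> open W \<and> W \<subseteq> U \<and> U \<subseteq> closure W \<and> (\<forall>z\<in>W. f z = g z))"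

text \<open>Equality of global sections of \<open>\<M>\<close>.\<close>

definition mero_eq :: "(complex ^ 'i::finite \<Rightarrow> complex) \<Rightarrow> (complex ^ 'i \<Rightarrow> complex) \<Rightarrow> bool" where
  "mero_eq f g \<longleftrightarrow> (\<forall>x. germ_eq x f g)"

text \<open>Representatives of the meromorphic (locally fractions of holomorphic germs), respectively
  rational, functions on \<open>V\<close>.\<close>

fun mero :: "geometry \<Rightarrow> (complex ^ 'i::finite \<Rightarrow> complex) set" where
  "mero Analytic = {f. \<forall>x. \<exists>p\<in>stalk Analytic x. \<exists>q\<in>stalk Analytic x.
      \<not> germ_eq x q (\<lambda>_. 0) \<and> germ_eq x f (\<lambda>z. p z / q z)}"
| "mero Algebraic = {f. \<exists>p q. poly_fun p \<and> poly_fun q \<and> q \<noteq> (\<lambda>_. 0) \<and>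
      mero_eq f (\<lambda>z. p z / q z)}"

fun global_regular :: "geometry \<Rightarrow> (complex ^ 'i::finite \<Rightarrow> complex) set" where
  "global_regular Analytic = {h. holomorphic_on_open UNIV h}"
| "global_regular Algebraic = {h. poly_fun h}"

definition is_regular :: "geometry \<Rightarrow> (complex ^ 'i::finite \<Rightarrow> complex) \<Rightarrow> bool" where
  "is_regular S f \<longleftrightarrow> (\<exists>h\<in>global_regular S. mero_eq f h)"


section \<open>The skew-group ring and its action\<close>

text \<open>The element \<open>\<Sum>\<^sub>\<xi> f\<^sub>\<xi> \<phi>\<^sub>\<xi>\<close> is represented by its coefficient function \<open>\<xi> \<mapsto> f\<^sub>\<xi>\<close>.\<close>

type_synonym 'i skew = "complex ^ 'i \<Rightarrow> complex ^ 'i \<Rightarrow> complex"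

definition skew_support :: "('i::finite) skew \<Rightarrow> (complex ^ 'i) set" where
  "skew_support A = {\<xi>. A \<xi> \<noteq> (\<lambda>_. 0)}"

definition skew_ring :: "geometry \<Rightarrow> ('i::finite) skew set" where
  "skew_ring S = {A. finite (skew_support A) \<and> (\<forall>\<xi>. A \<xi> \<in> mero S)}"

definition skew_eq :: "('i::finite) skew \<Rightarrow> 'i skew \<Rightarrow> bool" where
  "skew_eq A B \<longleftrightarrow> (\<forall>\<xi>. mero_eq (A \<xi>) (B \<xi>))"

definition skew_term :: "(complex ^ 'i \<Rightarrow> complex) \<Rightarrow> complex ^ 'i::finite \<Rightarrow> 'i skew" where
  "skew_term f \<xi> = (\<lambda>\<eta>. if \<eta> = \<xi> then f else (\<lambda>_. 0))"

text \<open>The action with \<open>g \<cdot> (f \<phi>\<^sub>\<xi>) = (g \<cdot> f) \<phi>\<close> at \<open>g \<cdot> \<xi>\<close>.\<close>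

definition act_skew ::
  "nat \<Rightarrow> (nat \<Rightarrow> nat) \<Rightarrow> (nat \<times> nat \<Rightarrow> 'i::finite) \<Rightarrow> (nat \<Rightarrow> nat \<Rightarrow> nat) \<Rightarrow>
    'i skew \<Rightarrow> 'i skew" where
  "act_skew n m pos g A =
    (\<lambda>\<eta>. act_fun n m pos g (A (act n m pos (inv\<^bsub>perm_group n m\<^esub> g) \<eta>)))"

definition skew_invariants ::
  "geometry \<Rightarrow> nat \<Rightarrow> (nat \<Rightarrow> nat) \<Rightarrow> (nat \<times> nat \<Rightarrow> 'i::finite) \<Rightarrow> 'i skew set" where
  "skew_invariants S n m pos =
    {A \<in> skew_ring S. \<forall>g\<in>carrier (perm_group n m). skew_eq (act_skew n m pos g A) A}"

text \<open>
  An element of the direct sum of all \<open>\<O>\<^sub>x\<close> is a family \<open>F\<close> of germs, \<open>F x\<close> at \<open>x\<close>, almost all zero.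
  As \<open>G\<close>-orbits are finite, the sum over all orbits of the \<open>G\<close>-invariants of the sums over single
  orbits is the space of \<open>G\<close>-invariant families.
\<close>

definition invariant_germs ::
  "geometry \<Rightarrow> nat \<Rightarrow> (nat \<Rightarrow> nat) \<Rightarrow> (nat \<times> nat \<Rightarrow> 'i::finite) \<Rightarrow>
    (complex ^ 'i \<Rightarrow> complex ^ 'i \<Rightarrow> complex) set" where
  "invariant_germs S n m pos =
    {F. (\<forall>x. F x \<in> stalk S x) \<and> finite {x. \<not> germ_eq x (F x) (\<lambda>_. 0)} \<and>
        (\<forall>g\<in>carrier (perm_group n m). \<forall>x.
          germ_eq (act n m pos g x) (F (act n m pos g x)) (act_fun n m pos g (F x)))}"

text \<open>\<open>f \<phi>\<^sub>\<xi>\<close> maps germs at \<open>y - \<xi>\<close> to germs at \<open>y\<close>.\<close>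

definition skew_apply ::
  "('i::finite) skew \<Rightarrow> (complex ^ 'i \<Rightarrow> complex ^ 'i \<Rightarrow> complex) \<Rightarrow>
    complex ^ 'i \<Rightarrow> complex ^ 'i \<Rightarrow> complex" where
  "skew_apply A F y = (\<lambda>z. \<Sum>\<xi>\<in>skew_support A. A \<xi> z * F (y - \<xi>) (z - \<xi>))"

definition preserves_invariant_germs ::
  "geometry \<Rightarrow> nat \<Rightarrow> (nat \<Rightarrow> nat) \<Rightarrow> (nat \<times> nat \<Rightarrow> 'i::finite) \<Rightarrow> 'i skew \<Rightarrow> bool" where
  "preserves_invariant_germs S n m pos A \<longleftrightarrow>
    (\<forall>F\<in>invariant_germs S n m pos. \<exists>F'\<in>invariant_germs S n m pos.
      \<forall>y. germ_eq y (skew_apply A F y) (F' y))"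


section \<open>Characters, \<open>d\<^sub>\<chi>\<close>, and generators of rational Galois orders\<close>

definition nonzero_complex :: "complex monoid" where
  "nonzero_complex = \<lparr>carrier = UNIV - {0}, mult = (*), one = 1\<rparr>"

definition is_hyperplane_form :: "(complex ^ 'i::finite) set \<Rightarrow> (complex ^ 'i \<Rightarrow> complex) \<Rightarrow> bool" where
  "is_hyperplane_form H \<gamma> \<longleftrightarrow>
    Vector_Spaces.linear (*s) (*) \<gamma> \<and> \<gamma> \<noteq> (\<lambda>_. 0) \<and> H = {v. \<gamma> v = 0}"

definition is_reflection ::
  "nat \<Rightarrow> (nat \<Rightarrow> nat) \<Rightarrow> (nat \<times> nat \<Rightarrow> 'i::finite) \<Rightarrow> (complex ^ 'i) set \<Rightarrow>
    (nat \<Rightarrow> nat \<Rightarrow> nat) \<Rightarrow> bool" where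
  "is_reflection n m pos H g \<longleftrightarrow> g \<in> carrier (perm_group n m) \<and>
    (\<exists>\<gamma>. is_hyperplane_form H \<gamma>) \<and> {v. act n m pos g v = v} = H"

definition refl_hyperplanes ::
  "nat \<Rightarrow> (nat \<Rightarrow> nat) \<Rightarrow> (nat \<times> nat \<Rightarrow> 'i::finite) \<Rightarrow> (complex ^ 'i) set set" where
  "refl_hyperplanes n m pos = {H. \<exists>g. is_reflection n m pos H g}"

text \<open>The reflections in \<open>G\<close> are the transpositions within a block, so the reflection fixing a
  given \<open>H\<close> is unique and the choice below is determined.\<close>

definition hyperplane_refl ::
  "nat \<Rightarrow> (nat \<Rightarrow> nat) \<Rightarrow> (nat \<times> nat \<Rightarrow> 'i::finite) \<Rightarrow> (complex ^ 'i) set \<Rightarrow>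
    nat \<Rightarrow> nat \<Rightarrow> nat" where
  "hyperplane_refl n m pos H = (SOME g. is_reflection n m pos H g)"

text \<open>The transpose is the matrix of the dual map on \<open>V\<^sup>*\<close>.\<close>

definition a_exp ::
  "nat \<Rightarrow> (nat \<Rightarrow> nat) \<Rightarrow> (nat \<times> nat \<Rightarrow> 'i::finite) \<Rightarrow> ((nat \<Rightarrow> nat \<Rightarrow> nat) \<Rightarrow> complex) \<Rightarrow>
    (complex ^ 'i) set \<Rightarrow> nat" where
  "a_exp n m pos ch H =
    (LEAST a. ch (hyperplane_refl n m pos H) =
      det (transpose (matrix (act n m pos (hyperplane_refl n m pos H)))) ^ a)"

text \<open>\<open>\<gamma> H\<close> is the chosen linear form with kernel \<open>H\<close>.\<close>

definition d_char ::
  "nat \<Rightarrow> (nat \<Rightarrow> nat) \<Rightarrow> (nat \<times> nat \<Rightarrow> 'i::finite) \<Rightarrow>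
    ((complex ^ 'i) set \<Rightarrow> complex ^ 'i \<Rightarrow> complex) \<Rightarrow>
    ((nat \<Rightarrow> nat \<Rightarrow> nat) \<Rightarrow> complex) \<Rightarrow> complex ^ 'i \<Rightarrow> complex" where
  "d_char n m pos \<gamma> ch v = (\<Prod>H\<in>refl_hyperplanes n m pos. \<gamma> H v ^ a_exp n m pos ch H)"

definition skew_regular :: "geometry \<Rightarrow> (complex ^ 'i::finite \<Rightarrow> complex) \<Rightarrow> 'i skew \<Rightarrow> bool" where
  "skew_regular S d A \<longleftrightarrow> (\<forall>\<xi>. is_regular S (\<lambda>z. d z * A \<xi> z))"

definition galois_order_generator ::
  "geometry \<Rightarrow> nat \<Rightarrow> (nat \<Rightarrow> nat) \<Rightarrow> (nat \<times> nat \<Rightarrow> 'i::finite) \<Rightarrow>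
    ((complex ^ 'i) set \<Rightarrow> complex ^ 'i \<Rightarrow> complex) \<Rightarrow> 'i skew \<Rightarrow> bool" where
  "galois_order_generator S n m pos \<gamma> A \<longleftrightarrow> A \<in> skew_invariants S n m pos \<and>
    (\<exists>ch\<in>hom (perm_group n m) nonzero_complex. skew_regular S (d_char n m pos \<gamma> ch) A)"

end

theory Submission
  imports Defs "HOL-Computational_Algebra.Fundamental_Theorem_Algebra"
begin

text \<open>
  The character is the product of the signs of the block permutations.  A reflection of \<open>G\<close> is a
  transposition inside one block, so this character takes the value \<open>-1\<close> on it, every exponent
  \<open>a\<^sub>H\<close> is \<open>1\<close>, and \<open>d = d\<^sub>\<chi>\<close> is, up to a constant, the product of the Vandermonde products of all blocks
  (\<open>d_char_sign_factor\<close>).  It remains to bound the poles of the coefficients \<open>A\<^sub>\<xi>\<close>.  Only shifts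
  \<open>\<xi> = a \<delta>\<^sup>k\<^sup>j\<close> have a nonzero coefficient, because \<open>G\<close> permutes such vectors.

  Fix a point \<open>y\<close> and a shift \<open>a \<delta>\<^sup>k\<^sup>j\<close> with \<open>a \<noteq> 0\<close>, and apply \<open>A\<close> to invariant germs supported on
  the orbit of \<open>y - a \<delta>\<^sup>k\<^sup>j\<close>.  Comparing block sums and the multisets of coordinates shows that the
  only shifts which carry this orbit to \<open>y\<close> are the \<open>a \<delta>\<^sup>k\<^sup>l\<close> with \<open>y\<^sub>k\<^sub>l = y\<^sub>k\<^sub>j\<close>
  (\<open>shifts_in_one_orbit\<close>); let \<open>J\<close> be the set of these \<open>l\<close> and \<open>B\<^sub>l\<close> their coefficients.  As test
  germs serve the power sums of exponent \<open>e\<close> over those coordinates of block \<open>k\<close> that equal \<open>y\<^sub>k\<^sub>j - a\<close> at the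
  point in question: selecting coordinates by their value makes the family invariant.  The image of
  the test germ at \<open>y\<close> is \<open>\<Sum>\<^sub>l\<^sub>\<in>\<^sub>J B\<^sub>l ((z\<^sub>k\<^sub>l - a)\<^sup>e + s\<^sub>e(z))\<close> with \<open>s\<^sub>e\<close> a polynomial that is the same for
  all \<open>l\<close>.  Exponent \<open>0\<close> shows that \<open>\<Sum>\<^sub>l B\<^sub>l\<close> is regular at \<open>y\<close>, hence so are all moments
  \<open>\<Sum>\<^sub>l B\<^sub>l (z\<^sub>k\<^sub>l - a)\<^sup>e\<close>.  Combining the moments with the coefficients of \<open>\<Prod>\<^sub>i\<^sub>\<in>\<^sub>J\<^sub>,\<^sub>i\<^sub>\<noteq>\<^sub>j (t - z\<^sub>k\<^sub>i + a)\<close>, a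
  polynomial in \<open>t\<close> vanishing at all nodes but the one of index \<open>j\<close>, isolates
  \<open>B\<^sub>j \<Prod>\<^sub>i\<^sub>\<noteq>\<^sub>j (z\<^sub>k\<^sub>j - z\<^sub>k\<^sub>i)\<close> (\<open>regular_germ_coefficient\<close>), and this product divides \<open>d\<close>.

  Regularity at every point is turned into global regularity by gluing.  In the algebraic case
  the glued function is a continuous quotient of polynomials; on coordinate lines it is a
  polynomial of bounded degree, and Lagrange interpolation in one coordinate after the other shows
  that it is a polynomial (\<open>poly_fun_quotient\<close>).
\<close>

section \<open>Equality of germs and regular germs\<close>

lemma dense_open_Int:
  fixes U U' W W' :: "'a::topological_space set"
  assumes "open U" "open U'" "open W" "open W'" "W \<subseteq> U" "U \<subseteq> closure W" "U' \<subseteq> closure W'"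
  shows "U \<inter> U' \<subseteq> closure (W \<inter> W')"
proof
  fix z assume z: "z \<in> U \<inter> U'"
  have "V \<inter> (W \<inter> W') \<noteq> {}" if V: "open V" "z \<in> V" for V
  proof -
    have "open (V \<inter> U \<inter> U')" using assms(1,2) V by (intro open_Int)
    moreover have "z \<in> (V \<inter> U \<inter> U') \<inter> closure W" using z V assms(6) by blast
    ultimately obtain w where w: "w \<in> V \<inter> U \<inter> U' \<inter> W"
      using open_Int_closure_eq_empty by blast
    have "open (V \<inter> U \<inter> U' \<inter> W)" using assms(1-3) V by (intro open_Int)
    moreover have "w \<in> (V \<inter> U \<inter> U' \<inter> W) \<inter> closure W'" using w assms(7) by blast
    ultimately show ?thesis using open_Int_closure_eq_empty by blast
  qed
  thus "z \<in> closure (W \<inter> W')" using open_Int_closure_eq_empty[of _ "W \<inter> W'"]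
    by (metis Compl_iff Compl_disjoint2 closed_closure closure_subset disjoint_iff open_Compl subsetD)
qed

text \<open>
  Two germ equalities hold simultaneously on a dense open set, so every pointwise consequence of
  them is again a germ equality.  Transitivity and the congruence rules are instances.
\<close>
lemma germ_eq_combine:
  assumes "germ_eq x f f'" "germ_eq x g g'"
    and imp: "\<And>z. f z = f' z \<Longrightarrow> g z = g' z \<Longrightarrow> h z = h' z"
  shows "germ_eq x h h'"
proof -
  from assms(1) obtain U W where U: "open U" "x \<in> U" "open W" "W \<subseteq> U" "U \<subseteq> closure W"
    "\<forall>z\<in>W. f z = f' z" unfolding germ_eq_def by blast
  from assms(2) obtain U' W' where U': "open U'" "x \<in> U'" "open W'" "W' \<subseteq> U'" "U' \<subseteq> closure W'"
    "\<forall>z\<in>W'. g z = g' z" unfolding germ_eq_def by blast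
  have "U \<inter> U' \<subseteq> closure (W \<inter> W')" by (rule dense_open_Int) (use U U' in auto)
  moreover have "\<forall>z\<in>W \<inter> W'. h z = h' z" using U(6) U'(6) imp by blast
  ultimately show ?thesis unfolding germ_eq_def using U U'
    by (intro exI[of _ "U \<inter> U'"] exI[of _ "W \<inter> W'"]) auto
qed

lemma germ_eq_near:
  assumes "\<forall>\<^sub>F z in nhds x. f z = g z"
  shows "germ_eq x f g"
proof -
  from assms obtain U where "open U" "x \<in> U" "\<forall>z\<in>U. f z = g z"
    unfolding eventually_nhds by blast
  thus ?thesis unfolding germ_eq_def
    by (intro exI[of _ U]) (auto intro: subsetD[OF closure_subset])
qed

lemma germ_eq_refl [simp]: "germ_eq x f f"
  by (rule germ_eq_near) simp

lemma germ_eq_sym: "germ_eq x f g \<Longrightarrow> germ_eq x g f"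
  by (rule germ_eq_combine[of x f g f g]) auto

lemma germ_eq_trans [trans]: "germ_eq x f g \<Longrightarrow> germ_eq x g h \<Longrightarrow> germ_eq x f h"
  by (erule (1) germ_eq_combine) simp

lemma germ_eq_mult:
  "germ_eq x f f' \<Longrightarrow> germ_eq x g g' \<Longrightarrow> germ_eq x (\<lambda>z. f z * g z) (\<lambda>z. f' z * g' z)"
  by (erule (1) germ_eq_combine) simp

lemma germ_eq_add:
  "germ_eq x f f' \<Longrightarrow> germ_eq x g g' \<Longrightarrow> germ_eq x (\<lambda>z. f z + g z) (\<lambda>z. f' z + g' z)"
  by (erule (1) germ_eq_combine) simp

lemma germ_eq_sum:
  assumes "\<And>k. k \<in> I \<Longrightarrow> germ_eq x (f k) (g k)"
  shows "germ_eq x (\<lambda>z. \<Sum>k\<in>I. f k z) (\<lambda>z. \<Sum>k\<in>I. g k z)"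
  using assms by (induction I rule: infinite_finite_induct) (auto intro!: germ_eq_add)

text \<open>Germ equality at a point spreads to a neighbourhood; this is what makes gluing possible.\<close>
lemma germ_eq_eventually:
  assumes "germ_eq x f g"
  shows "\<forall>\<^sub>F y in nhds x. germ_eq y f g"
proof -
  from assms obtain U W where "open U" "x \<in> U" "open W" "W \<subseteq> U" "U \<subseteq> closure W"
    "\<forall>z\<in>W. f z = g z" unfolding germ_eq_def by blast
  thus ?thesis unfolding eventually_nhds germ_eq_def by blast
qed

text \<open>
  If the values at \<open>x\<close> differed, continuity would keep \<open>f - g\<close> away from \<open>0\<close> on a neighbourhood of
  \<open>x\<close>, and that neighbourhood meets the dense set of agreement.
\<close>
lemma germ_eq_isCont:
  assumes "germ_eq x f g" "isCont f x" "isCont g x"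
  shows "f x = g x"
proof (rule ccontr)
  assume ne: "f x \<noteq> g x"
  from assms(1) obtain U W where U: "open U" "x \<in> U" "open W" "W \<subseteq> U" "U \<subseteq> closure W"
    "\<forall>z\<in>W. f z = g z" unfolding germ_eq_def by blast
  have "isCont (\<lambda>z. f z - g z) x" using assms by (intro continuous_intros)
  hence "((\<lambda>z. f z - g z) \<longlongrightarrow> f x - g x) (nhds x)"
    unfolding continuous_at tendsto_at_iff_tendsto_nhds[of "\<lambda>z. f z - g z" x] .
  hence "\<forall>\<^sub>F z in nhds x. f z - g z \<noteq> 0"
    by (rule tendsto_imp_eventually_ne) (use ne in simp)
  then obtain V where V: "open V" "x \<in> V" "\<forall>z\<in>V. f z - g z \<noteq> 0"
    unfolding eventually_nhds by blast
  have "V \<inter> W \<noteq> {}" using V U by (subst open_Int_closure_eq_empty[symmetric]) auto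
  thus False using V U by auto
qed

definition complex_differentiable_at :: "(complex ^ 'i::finite \<Rightarrow> complex) \<Rightarrow> complex ^ 'i \<Rightarrow> bool" where
  "complex_differentiable_at f x \<longleftrightarrow>
    (\<exists>D. (f has_derivative D) (at x) \<and> Vector_Spaces.linear (*s) (*) D)"

lemma complex_linear_iff:
  fixes D :: "complex ^ 'i::finite \<Rightarrow> complex"
  shows "Vector_Spaces.linear (*s) (*) D \<longleftrightarrow>
    (\<forall>x y. D (x + y) = D x + D y) \<and> (\<forall>c x. D (c *s x) = c * D x)"
  by (simp add: Vector_Spaces.linear_iff vec.vector_space_axioms
      vector_space_over_itself.vector_space_axioms)

lemma complex_differentiable_add:
  assumes "complex_differentiable_at f x" "complex_differentiable_at g x"
  shows "complex_differentiable_at (\<lambda>z. f z + g z) x"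
proof -
  from assms obtain D E where D: "(f has_derivative D) (at x)" "Vector_Spaces.linear (*s) (*) D"
    and E: "(g has_derivative E) (at x)" "Vector_Spaces.linear (*s) (*) E"
    unfolding complex_differentiable_at_def by blast
  have "((\<lambda>z. f z + g z) has_derivative (\<lambda>h. D h + E h)) (at x)"
    using D E by (intro has_derivative_add)
  moreover have "Vector_Spaces.linear (*s) (*) (\<lambda>h. D h + E h)"
    using D(2) E(2) by (simp add: complex_linear_iff algebra_simps)
  ultimately show ?thesis unfolding complex_differentiable_at_def by blast
qed

lemma complex_differentiable_mult:
  assumes "complex_differentiable_at f x" "complex_differentiable_at g x"
  shows "complex_differentiable_at (\<lambda>z. f z * g z) x"
proof -
  from assms obtain D E where D: "(f has_derivative D) (at x)" "Vector_Spaces.linear (*s) (*) D"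
    and E: "(g has_derivative E) (at x)" "Vector_Spaces.linear (*s) (*) E"
    unfolding complex_differentiable_at_def by blast
  have "((\<lambda>z. f z * g z) has_derivative (\<lambda>h. f x * E h + D h * g x)) (at x)"
    using D E by (intro has_derivative_mult)
  moreover have "Vector_Spaces.linear (*s) (*) (\<lambda>h. f x * E h + D h * g x)"
    using D(2) E(2) by (simp add: complex_linear_iff algebra_simps)
  ultimately show ?thesis unfolding complex_differentiable_at_def by blast
qed

lemma complex_differentiable_poly_fun:
  assumes "poly_fun f" shows "complex_differentiable_at f x"
  using assms
proof induction
  case (const c)
  have "((\<lambda>_. c) has_derivative (\<lambda>_. 0)) (at x)" by simp
  moreover have "Vector_Spaces.linear (*s) (*) (\<lambda>_::complex ^ 'a. 0)"
    by (simp add: complex_linear_iff)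
  ultimately show ?case unfolding complex_differentiable_at_def by blast
next
  case (coord q)
  have "((\<lambda>v. v $ q) has_derivative (\<lambda>v. v $ q)) (at x)"
    by (rule bounded_linear_imp_has_derivative) (rule bounded_linear_vec_nth)
  moreover have "Vector_Spaces.linear (*s) (*) (\<lambda>v::complex ^ 'a. v $ q)"
    by (simp add: complex_linear_iff)
  ultimately show ?case unfolding complex_differentiable_at_def by blast
qed (simp_all add: complex_differentiable_add complex_differentiable_mult)

lemma poly_fun_isCont: "poly_fun f \<Longrightarrow> isCont f x"
  by (induction rule: poly_fun.induct) (auto intro!: continuous_intros)

lemma holomorphic_on_open_iff:
  "holomorphic_on_open U f \<longleftrightarrow> open U \<and> (\<forall>x\<in>U. complex_differentiable_at f x)"
  by (simp add: holomorphic_on_open_def complex_differentiable_at_def)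

lemma stalk_poly_fun: "poly_fun f \<Longrightarrow> f \<in> stalk S x"
proof (cases S)
  case Analytic
  assume "poly_fun f"
  thus ?thesis unfolding Analytic stalk.simps
    by (intro CollectI exI[of _ UNIV]) (simp add: holomorphic_on_open_iff complex_differentiable_poly_fun)
next
  case Algebraic
  assume f: "poly_fun f"
  have "poly_fun (\<lambda>_::complex ^ 'a. 1)" by (rule poly_fun.const)
  thus ?thesis unfolding Algebraic stalk.simps using f
    by (intro CollectI exI[of _ f] exI[of _ "\<lambda>_. 1"]) simp
qed

lemma poly_fun_nonzero_nearby:
  assumes "poly_fun q" "q x \<noteq> 0"
  shows "\<forall>\<^sub>F z in nhds x. q z \<noteq> 0"
proof -
  have "(q \<longlongrightarrow> q x) (nhds x)"
    using poly_fun_isCont[OF assms(1)] by (simp add: continuous_at tendsto_at_iff_tendsto_nhds)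
  thus ?thesis using assms(2) by (rule tendsto_imp_eventually_ne)
qed

lemma stalk_add:
  assumes "f \<in> stalk S x" "g \<in> stalk S x"
  shows "(\<lambda>z. f z + g z) \<in> stalk S x"
proof (cases S)
  case Analytic
  then obtain U V where "x \<in> U" "holomorphic_on_open U f" "x \<in> V" "holomorphic_on_open V g"
    using assms by auto
  thus ?thesis unfolding Analytic stalk.simps
    by (intro CollectI exI[of _ "U \<inter> V"]) (auto simp: holomorphic_on_open_iff complex_differentiable_add)
next
  case Algebraic
  then obtain p q p' q' where *: "poly_fun p" "poly_fun q" "q x \<noteq> 0" "poly_fun p'" "poly_fun q'"
    "q' x \<noteq> 0" "\<forall>\<^sub>F z in nhds x. f z = p z / q z" "\<forall>\<^sub>F z in nhds x. g z = p' z / q' z"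
    using assms by auto
  have "\<forall>\<^sub>F z in nhds x. f z + g z = (p z * q' z + p' z * q z) / (q z * q' z)"
    using *(7,8) poly_fun_nonzero_nearby[OF *(2,3)] poly_fun_nonzero_nearby[OF *(5,6)]
    by eventually_elim (simp add: field_simps)
  moreover have "poly_fun (\<lambda>z. p z * q' z + p' z * q z)" "poly_fun (\<lambda>z. q z * q' z)"
    using * by (auto intro!: poly_fun.intros)
  moreover have "q x * q' x \<noteq> 0" using * by simp
  ultimately show ?thesis unfolding Algebraic stalk.simps by blast
qed

lemma stalk_mult:
  assumes "f \<in> stalk S x" "g \<in> stalk S x"
  shows "(\<lambda>z. f z * g z) \<in> stalk S x"
proof (cases S)
  case Analytic
  then obtain U V where "x \<in> U" "holomorphic_on_open U f" "x \<in> V" "holomorphic_on_open V g"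
    using assms by auto
  thus ?thesis unfolding Analytic stalk.simps
    by (intro CollectI exI[of _ "U \<inter> V"]) (auto simp: holomorphic_on_open_iff complex_differentiable_mult)
next
  case Algebraic
  then obtain p q p' q' where *: "poly_fun p" "poly_fun q" "q x \<noteq> 0" "poly_fun p'" "poly_fun q'"
    "q' x \<noteq> 0" "\<forall>\<^sub>F z in nhds x. f z = p z / q z" "\<forall>\<^sub>F z in nhds x. g z = p' z / q' z"
    using assms by auto
  have "\<forall>\<^sub>F z in nhds x. f z * g z = (p z * p' z) / (q z * q' z)"
    using *(7,8) by eventually_elim simp
  moreover have "poly_fun (\<lambda>z. p z * p' z)" "poly_fun (\<lambda>z. q z * q' z)"
    using * by (auto intro!: poly_fun.intros)
  moreover have "q x * q' x \<noteq> 0" using * by simp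
  ultimately show ?thesis unfolding Algebraic stalk.simps by blast
qed

lemma stalk_isCont_eventually:
  assumes "f \<in> stalk S x"
  shows "\<forall>\<^sub>F y in nhds x. isCont f y"
proof (cases S)
  case Analytic
  then obtain U where U: "x \<in> U" "holomorphic_on_open U f"
    using assms by auto
  hence "open U" "\<And>y. y \<in> U \<Longrightarrow> isCont f y"
    unfolding holomorphic_on_open_def using has_derivative_continuous by blast+
  thus ?thesis unfolding eventually_nhds using U(1) by blast
next
  case Algebraic
  then obtain p q where *: "poly_fun p" "poly_fun q" "q x \<noteq> 0"
    "\<forall>\<^sub>F z in nhds x. f z = p z / q z"
    using assms by auto
  have "\<forall>\<^sub>F y in nhds x. \<forall>\<^sub>F z in nhds y. f z = p z / q z"
    using *(4) by (simp add: eventually_eventually)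
  thus ?thesis using poly_fun_nonzero_nearby[OF *(2,3)]
  proof eventually_elim
    case (elim y)
    have "isCont (\<lambda>z. p z / q z) y"
      using *(1,2) elim(2) by (intro continuous_intros poly_fun_isCont)
    thus ?case using isCont_cong[OF elim(1)] by blast
  qed
qed

text \<open>
  The germs of \<open>\<M>\<^sub>y\<close> that lie in \<open>\<O>\<^sub>y\<close>.  Working with these germs rather than with functions makes
  the analytic and the algebraic case run in parallel: to bound poles it suffices that they form
  a ring containing the polynomials.
\<close>
definition regular_germ :: "geometry \<Rightarrow> complex ^ 'i::finite \<Rightarrow> (complex ^ 'i \<Rightarrow> complex) \<Rightarrow> bool" where
  "regular_germ S y f \<longleftrightarrow> (\<exists>r\<in>stalk S y. germ_eq y f r)"

lemma regular_germ_add: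
  "regular_germ S y f \<Longrightarrow> regular_germ S y g \<Longrightarrow> regular_germ S y (\<lambda>z. f z + g z)"
  unfolding regular_germ_def by (blast intro: germ_eq_add stalk_add)

lemma regular_germ_mult:
  "regular_germ S y f \<Longrightarrow> regular_germ S y g \<Longrightarrow> regular_germ S y (\<lambda>z. f z * g z)"
  unfolding regular_germ_def by (blast intro: germ_eq_mult stalk_mult)

lemma regular_germ_poly_fun: "poly_fun f \<Longrightarrow> regular_germ S y f"
  unfolding regular_germ_def using stalk_poly_fun germ_eq_refl by blast

lemma regular_germ_diff:
  assumes "regular_germ S y f" "regular_germ S y g"
  shows "regular_germ S y (\<lambda>z. f z - g z)"
proof -
  have "regular_germ S y (\<lambda>z. -1 * g z)"
    by (rule regular_germ_mult[OF regular_germ_poly_fun assms(2)]) (rule poly_fun.const)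
  from regular_germ_add[OF assms(1) this] show ?thesis by simp
qed

lemma regular_germ_cong: "germ_eq y f g \<Longrightarrow> regular_germ S y g \<Longrightarrow> regular_germ S y f"
  unfolding regular_germ_def by (blast intro: germ_eq_trans)

text \<open>
  Take as value at \<open>y\<close> the value of the regular representative there.  Near a point two such
  representatives are continuous and equal as germs, hence equal.
\<close>
lemma regular_germs_glue:
  assumes "\<And>y. regular_germ S y f"
  obtains h where "mero_eq f h" "\<And>y. \<exists>r\<in>stalk S y. \<forall>\<^sub>F z in nhds y. h z = r z"
proof -
  from assms have "\<forall>y. \<exists>r. r \<in> stalk S y \<and> germ_eq y f r" unfolding regular_germ_def by blast
  then obtain r where r: "\<And>y. r y \<in> stalk S y" "\<And>y. germ_eq y f (r y)" by metis
  define h where "h y = r y y" for y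
  have near: "\<forall>\<^sub>F z in nhds y. h z = r y z" for y
    using germ_eq_eventually[OF r(2)[of y]] stalk_isCont_eventually[OF r(1)[of y]]
  proof eventually_elim
    case (elim z)
    have "isCont (r z) z"
      using stalk_isCont_eventually[OF r(1)[of z]] by (rule eventually_nhds_x_imp_x)
    moreover have "germ_eq z (r z) (r y)"
      using germ_eq_trans[OF germ_eq_sym[OF r(2)] elim(1)] .
    ultimately show ?case unfolding h_def using elim(2) germ_eq_isCont by blast
  qed
  have "germ_eq y f h" for y
    using germ_eq_trans[OF r(2)[of y] germ_eq_sym[OF germ_eq_near[OF near]]] .
  hence "mero_eq f h" by (simp add: mero_eq_def)
  moreover have "\<exists>r\<in>stalk S y. \<forall>\<^sub>F z in nhds y. h z = r z" for y using r(1) near by blast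
  ultimately show ?thesis using that by blast
qed

section \<open>Polynomial functions\<close>

lemma poly_fun_sum:
  "(\<And>k. k \<in> I \<Longrightarrow> poly_fun (f k)) \<Longrightarrow> poly_fun (\<lambda>z. \<Sum>k\<in>I. f k z)"
  by (induction I rule: infinite_finite_induct) (auto intro: poly_fun.intros)

lemma poly_fun_prod:
  "(\<And>k. k \<in> I \<Longrightarrow> poly_fun (f k)) \<Longrightarrow> poly_fun (\<lambda>z. \<Prod>k\<in>I. f k z)"
  by (induction I rule: infinite_finite_induct) (auto intro: poly_fun.intros)

lemma poly_fun_power: "poly_fun f \<Longrightarrow> poly_fun (\<lambda>z. f z ^ e)"
  by (induction e) (auto intro: poly_fun.intros)

lemma poly_fun_diff:
  assumes "poly_fun f" "poly_fun g" shows "poly_fun (\<lambda>z. f z - g z)"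
proof -
  have "poly_fun (\<lambda>z. f z + (-1) * g z)" by (intro poly_fun.intros assms)
  thus ?thesis by simp
qed

lemma poly_fun_poly: "poly_fun f \<Longrightarrow> poly_fun (\<lambda>z. poly u (f z))"
  by (induction u) (auto intro: poly_fun.intros)

text \<open>Expand the argument in the standard basis.\<close>
lemma poly_fun_complex_linear:
  fixes l :: "complex ^ 'i::finite \<Rightarrow> complex"
  assumes "Vector_Spaces.linear (*s) (*) l"
  shows "poly_fun l"
proof -
  have l: "l (x + y) = l x + l y" "l (c *s x) = c * l x" for x y c
    using assms by (simp_all add: complex_linear_iff)
  have "l 0 = 0" using l(1)[of 0 0] by simp
  hence sum: "l (\<Sum>q\<in>I. f q) = (\<Sum>q\<in>I. l (f q))" for f :: "'i \<Rightarrow> _" and I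
    by (induction I rule: infinite_finite_induct) (simp_all add: l(1))
  have "l v = (\<Sum>q\<in>UNIV. v $ q * l (axis q 1))" for v
  proof -
    have "v = (\<Sum>q\<in>UNIV. v $ q *s axis q 1)" by (simp add: basis_expansion)
    thus ?thesis using sum[of "\<lambda>q. v $ q *s axis q 1" UNIV] by (simp add: l(2))
  qed
  hence "l = (\<lambda>v. \<Sum>q\<in>UNIV. v $ q * l (axis q 1))" by blast
  moreover have "poly_fun (\<lambda>v. \<Sum>q\<in>UNIV. v $ q * l (axis q 1))"
    by (intro poly_fun_sum poly_fun.intros)
  ultimately show ?thesis by simp
qed

text \<open>The bound on the degree is uniform in the line, as the interpolation below requires.\<close>
lemma poly_fun_on_lines:
  assumes "poly_fun f"
  shows "\<exists>D. \<forall>v w. \<exists>u. degree u \<le> D \<and> (\<forall>t. f (v + t *s w) = poly u t)"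
  using assms
proof induction
  case (const c)
  show ?case by (intro exI[of _ 0] allI exI[of _ "[:c:]"]) simp
next
  case (coord q)
  show ?case
    by (rule exI[of _ "1::nat"], intro allI) (rule_tac x = "[:v $ q, w $ q:]" in exI, simp)
next
  case (add f g)
  then obtain D E where
    D: "\<And>v w. \<exists>u. degree u \<le> D \<and> (\<forall>t. f (v + t *s w) = poly u t)" and
    E: "\<And>v w. \<exists>u. degree u \<le> E \<and> (\<forall>t. g (v + t *s w) = poly u t)" by blast
  show ?case
  proof (intro exI[of _ "max D E"] allI)
    fix v w
    obtain u u' where "degree u \<le> D" "\<forall>t. f (v + t *s w) = poly u t"
      "degree u' \<le> E" "\<forall>t. g (v + t *s w) = poly u' t" using D E by blast
    thus "\<exists>u. degree u \<le> max D E \<and> (\<forall>t. f (v + t *s w) + g (v + t *s w) = poly u t)"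
      by (intro exI[of _ "u + u'"]) (auto intro: degree_add_le)
  qed
next
  case (mult f g)
  then obtain D E where
    D: "\<And>v w. \<exists>u. degree u \<le> D \<and> (\<forall>t. f (v + t *s w) = poly u t)" and
    E: "\<And>v w. \<exists>u. degree u \<le> E \<and> (\<forall>t. g (v + t *s w) = poly u t)" by blast
  show ?case
  proof (intro exI[of _ "D + E"] allI)
    fix v w
    obtain u u' where *: "degree u \<le> D" "\<forall>t. f (v + t *s w) = poly u t"
      "degree u' \<le> E" "\<forall>t. g (v + t *s w) = poly u' t" using D E by blast
    have "degree (u * u') \<le> D + E"
      using degree_mult_le[of u u'] *(1,3) by linarith
    thus "\<exists>u. degree u \<le> D + E \<and> (\<forall>t. f (v + t *s w) * g (v + t *s w) = poly u t)"
      using * by (intro exI[of _ "u * u'"]) auto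
  qed
qed

text \<open>
  On the line from \<open>x\<close> to a point where \<open>q\<close> does not vanish, \<open>q\<close> is a nonzero polynomial in one
  variable; it has finitely many zeros, so \<open>x\<close> is a limit of points where \<open>q\<close> does not vanish.
\<close>
lemma poly_fun_nonzero_dense:
  assumes q: "poly_fun q" "q \<noteq> (\<lambda>_. 0)"
  shows "closure {z. q z \<noteq> 0} = UNIV"
proof -
  have "x \<in> closure {z. q z \<noteq> 0}" for x
  proof (rule ccontr)
    assume x: "x \<notin> closure {z. q z \<noteq> 0}"
    obtain w where w: "q w \<noteq> 0" using q(2) by auto
    obtain u where u: "\<And>t. q (x + t *s (w - x)) = poly u t"
      using poly_fun_on_lines[OF q(1)] by blast
    have "poly u 1 \<noteq> 0" using u[of 1] w by simp
    hence fin: "finite {t. poly u t = 0}" by (intro poly_roots_finite) auto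
    have "isCont (\<lambda>t. x + t *s (w - x)) 0"
      unfolding vector_scalar_mult_def continuous_at
      by (intro tendsto_intros tendsto_vec_lambda)
    hence "((\<lambda>t. x + t *s (w - x)) \<longlongrightarrow> x) (at 0)" by (simp add: isCont_def)
    moreover have "open (- closure {z. q z \<noteq> 0})" "x \<in> - closure {z. q z \<noteq> 0}"
      using x by auto
    ultimately have "\<forall>\<^sub>F t in at 0. x + t *s (w - x) \<in> - closure {z. q z \<noteq> 0}"
      by (rule topological_tendstoD)
    hence "\<forall>\<^sub>F t in at 0. poly u t = 0"
    proof eventually_elim
      case (elim t)
      thus ?case using closure_subset[of "{z. q z \<noteq> 0}"] u[of t] by force
    qed
    moreover have "\<forall>\<^sub>F t in at 0. t \<in> - ({t. poly u t = 0} - {0})"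
    proof -
      have "open (- ({t. poly u t = 0} - {0}))" using fin by (intro open_Compl finite_imp_closed) auto
      from eventually_nhds_in_open[OF this, of 0] show ?thesis by (simp add: eventually_nhds_conv_at)
    qed
    moreover have "\<forall>\<^sub>F t in at (0::complex). t \<noteq> 0" by (simp add: eventually_at_filter)
    ultimately have "\<forall>\<^sub>F t in at (0::complex). False"
      by eventually_elim auto
    thus False by simp
  qed
  thus ?thesis by blast
qed

lemma dense_continuous_eq:
  fixes f g :: "'a::topological_space \<Rightarrow> complex"
  assumes "closure W = UNIV" "continuous_on UNIV f" "continuous_on UNIV g"
    and "\<And>z. z \<in> W \<Longrightarrow> f z = g z"
  shows "f z = g z"
proof -
  have "closed {z. f z = g z}" using assms(2,3) by (rule closed_Collect_eq)
  moreover have "W \<subseteq> {z. f z = g z}" using assms(4) by blast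
  ultimately have "closure W \<subseteq> {z. f z = g z}" by (rule closure_minimal[rotated])
  thus ?thesis using assms(1) by auto
qed

text \<open>
  Every root of \<open>q\<close> is a root of \<open>p\<close>, because \<open>p = q h\<close> with a finite value of \<open>h\<close> at the root.
  Cancelling the linear factor leaves an equation that holds off the root, hence everywhere
  by continuity; so roots are removed until \<open>q\<close> is constant.
\<close>
lemma continuous_quotient_is_poly:
  fixes q p :: "complex poly"
  assumes "q \<noteq> 0" "continuous_on UNIV h" "\<And>t. poly q t * h t = poly p t"
  shows "\<exists>u. degree u \<le> degree p \<and> (\<forall>t. h t = poly u t)"
  using assms
proof (induction "degree q" arbitrary: q p)
  case 0
  then obtain c where c: "q = [:c:]" by (metis degree_eq_zeroE)
  hence "c \<noteq> 0" using 0 by auto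
  hence "h t = poly (smult (1/c) p) t" for t using 0(4)[of t] c by (simp add: field_simps)
  thus ?case by (intro exI[of _ "smult (1/c) p"]) auto
next
  case (Suc d)
  have "\<not> constant (poly q)" using Suc(2) by (simp add: constant_degree)
  then obtain r where r: "poly q r = 0" using fundamental_theorem_of_algebra by blast
  then obtain q' where q': "q = [:-r, 1:] * q'" by (metis dvdE poly_eq_0_iff_dvd)
  have "poly p r = 0" using Suc(5)[of r] r by simp
  then obtain p' where p': "p = [:-r, 1:] * p'" by (metis dvdE poly_eq_0_iff_dvd)
  have q'0: "q' \<noteq> 0" using q' Suc(3) by auto
  hence "degree q = Suc (degree q')" using q' by (simp add: degree_mult_eq del: mult_pCons_left)
  hence deg: "d = degree q'" using Suc(2) by simp
  have "poly q' t * h t = poly p' t" for t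
  proof (rule dense_continuous_eq[of "- {r}" "\<lambda>t. poly q' t * h t" "poly p'"])
    show "closure (- {r}) = UNIV" by (simp add: closure_complement)
    show "poly q' z * h z = poly p' z" if "z \<in> - {r}" for z
    proof -
      have "(z - r) * (poly q' z * h z) = (z - r) * poly p' z"
        using Suc(5)[of z] q' p' by (simp add: algebra_simps)
      thus ?thesis using that by simp
    qed
  qed (use Suc(4) in \<open>auto intro!: continuous_intros\<close>)
  from Suc(1)[OF deg q'0 Suc(4) this] obtain u where
    u: "degree u \<le> degree p'" "\<forall>t. h t = poly u t" by blast
  have "degree p' \<le> degree p"
    using p' by (cases "p' = 0") (auto simp: degree_mult_eq simp del: mult_pCons_left)
  thus ?case using u by (intro exI[of _ u]) auto
qed

text \<open>The Lagrange polynomials for the nodes \<open>0, \<dots>, D\<close>.\<close>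
definition lagrange_basis :: "nat \<Rightarrow> nat \<Rightarrow> complex poly" where
  "lagrange_basis D i =
    (\<Prod>j\<in>{..D} - {i}. smult (1 / (of_nat i - of_nat j)) [:- of_nat j, 1:])"

lemma poly_lagrange_basis:
  assumes "i \<le> D" "j \<le> D"
  shows "poly (lagrange_basis D i) (of_nat j) = (if i = j then 1 else 0)"
proof (cases "i = j")
  case True
  have "poly (lagrange_basis D i) (of_nat j) =
    (\<Prod>k\<in>{..D} - {i}. (of_nat i - of_nat k) / (of_nat i - of_nat k))"
    unfolding lagrange_basis_def poly_prod True
    by (intro prod.cong) (auto simp: diff_divide_distrib[symmetric])
  also have "\<dots> = 1" by (intro prod.neutral) auto
  finally show ?thesis using True by simp
next
  case False
  have "poly (lagrange_basis D i) (of_nat j) = 0"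
    unfolding lagrange_basis_def poly_prod using False assms by (intro prod_zero) auto
  thus ?thesis using False by simp
qed

lemma degree_lagrange_basis:
  assumes "i \<le> D" shows "degree (lagrange_basis D i) \<le> D"
proof -
  have "degree (lagrange_basis D i) \<le>
    (\<Sum>j\<in>{..D} - {i}. degree (smult (1 / (of_nat i - of_nat j)) [:- of_nat j, 1 :: complex:]))"
    unfolding lagrange_basis_def by (rule order.trans[OF degree_prod_sum_le]) (simp_all add: o_def)
  also have "\<dots> \<le> (\<Sum>j\<in>{..D} - {i}. 1)"
    by (intro sum_mono) (auto intro: order.trans[OF degree_smult_le])
  also have "\<dots> = D" using assms by simp
  finally show ?thesis .
qed

lemma lagrange_interpolation:
  fixes u :: "complex poly"
  assumes "degree u \<le> D"
  shows "u = (\<Sum>i\<le>D. smult (poly u (of_nat i)) (lagrange_basis D i))"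
proof (rule poly_eqI_degree[of "of_nat ` {..D}"])
  have "card (of_nat ` {..D} :: complex set) = Suc D"
    by (subst card_image) (auto simp: inj_on_def)
  moreover have "degree (\<Sum>i\<le>D. smult (poly u (of_nat i)) (lagrange_basis D i)) \<le> D"
    by (intro degree_sum_le order.trans[OF degree_smult_le] degree_lagrange_basis) auto
  ultimately show
    "card (of_nat ` {..D} :: complex set) > degree (\<Sum>i\<le>D. smult (poly u (of_nat i)) (lagrange_basis D i))"
    "card (of_nat ` {..D} :: complex set) > degree u"
    using assms by auto
next
  fix x :: complex assume "x \<in> of_nat ` {..D}"
  then obtain j where j: "j \<le> D" "x = of_nat j" by auto
  have "poly (\<Sum>i\<le>D. smult (poly u (of_nat i)) (lagrange_basis D i)) x =
    (\<Sum>i\<le>D. if i = j then poly u x else 0)"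
    unfolding poly_sum j(2) using j(1) by (intro sum.cong) (auto simp: poly_lagrange_basis)
  thus "poly u x = poly (\<Sum>i\<le>D. smult (poly u (of_nat i)) (lagrange_basis D i)) x"
    using j(1) by simp
qed

definition coord_upd :: "complex ^ 'i \<Rightarrow> 'i \<Rightarrow> complex \<Rightarrow> complex ^ 'i" where
  "coord_upd v q t = (\<chi> r. if r = q then t else v $ r)"

text \<open>
  Interpolating in one coordinate after the other expresses \<open>h\<close> by its finitely many values on a
  grid.  The induction frees the coordinates in \<open>F\<close> while the others are frozen at those of \<open>c\<close>;
  the vector \<open>c\<close> must be arbitrary because each step moves one of its coordinates to a node.
\<close>
lemma poly_fun_if_interpolates:
  fixes h :: "complex ^ 'i::finite \<Rightarrow> complex"
  assumes "\<And>v q. h v = (\<Sum>k\<le>D. h (coord_upd v q (of_nat k)) * poly (L k) (v $ q))"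
  shows "poly_fun h"
proof -
  have "poly_fun (\<lambda>v. h (\<chi> r. if r \<in> F then v $ r else c $ r))" for F c
  proof -
    have "finite F" by simp
    thus ?thesis
    proof (induction F arbitrary: c rule: finite_induct)
      case empty
      show ?case by (simp add: poly_fun.const)
    next
      case (insert q F)
      define g where "g k v = h (\<chi> r. if r \<in> F then v $ r else coord_upd c q (of_nat k) $ r)"
        for k :: nat and v :: "complex ^ 'i"
      have "h (\<chi> r. if r \<in> insert q F then v $ r else c $ r) =
        (\<Sum>k\<le>D. g k v * poly (L k) (v $ q))" for v
      proof -
        have "coord_upd (\<chi> r. if r \<in> insert q F then v $ r else c $ r) q (of_nat k) =
          (\<chi> r. if r \<in> F then v $ r else coord_upd c q (of_nat k) $ r)" for k :: nat
          using insert(2) by (auto simp: coord_upd_def vec_eq_iff)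
        thus ?thesis
          by (subst assms[of _ q]) (simp add: g_def)
      qed
      moreover have "poly_fun (\<lambda>v. \<Sum>k\<le>D. g k v * poly (L k) (v $ q))"
        unfolding g_def by (intro poly_fun_sum poly_fun.mult insert.IH poly_fun_poly poly_fun.coord)
      ultimately show ?case by simp
    qed
  qed
  from this[of UNIV] show ?thesis by simp
qed

text \<open>
  On a coordinate line through a point with \<open>q \<noteq> 0\<close> the function \<open>h\<close> is a polynomial whose degree
  is at most that of \<open>p\<close>, so it satisfies the interpolation identity there.  Such points are dense
  and both sides of the identity are continuous, so the identity also holds on the
  lines on which \<open>q\<close> vanishes identically.
\<close>
lemma poly_fun_quotient:
  fixes h :: "complex ^ 'i::finite \<Rightarrow> complex"
  assumes p: "poly_fun p" and q: "poly_fun q" "q \<noteq> (\<lambda>_. 0)"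
    and h: "continuous_on UNIV h" "\<And>z. q z * h z = p z"
  shows "poly_fun h"
proof -
  obtain D where D: "\<And>v w. \<exists>u. degree u \<le> D \<and> (\<forall>t. p (v + t *s w) = poly u t)"
    using poly_fun_on_lines[OF p] by blast
  have "h v = (\<Sum>k\<le>D. h (coord_upd v r (of_nat k)) * poly (lagrange_basis D k) (v $ r))" for v r
  proof (rule dense_continuous_eq[OF poly_fun_nonzero_dense[OF q] h(1)])
    have upd: "continuous_on UNIV (\<lambda>v. coord_upd v r t :: complex ^ 'i)" for t
      unfolding coord_upd_def
    proof (rule continuous_on_vec_lambda)
      show "continuous_on UNIV (\<lambda>v. if s = r then t else v $ s)" for s :: 'i
        by (cases "s = r") (auto intro!: continuous_intros)
    qed
    show "continuous_on UNIV
      (\<lambda>v. \<Sum>k\<le>D. h (coord_upd v r (of_nat k)) * poly (lagrange_basis D k) (v $ r))"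
      by (intro continuous_intros continuous_on_compose2[OF h(1) upd]) auto
  next
    fix v assume v: "v \<in> {z. q z \<noteq> 0}"
    define w where "w = coord_upd v r 0"
    have line: "coord_upd v r t = w + t *s axis r 1" for t
      by (auto simp: w_def coord_upd_def vec_eq_iff axis_def)
    have self: "coord_upd v r (v $ r) = v" by (simp add: coord_upd_def vec_eq_iff)
    obtain up where up: "degree up \<le> D" "\<And>t. p (w + t *s axis r 1) = poly up t"
      using D by blast
    obtain uq where uq: "\<And>t. q (w + t *s axis r 1) = poly uq t"
      using poly_fun_on_lines[OF q(1)] by blast
    have "poly uq (v $ r) \<noteq> 0" using uq[of "v $ r"] v line self by simp
    hence "uq \<noteq> 0" by auto
    moreover have "continuous_on UNIV (\<lambda>t. h (w + t *s axis r 1))"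
      by (rule continuous_on_compose2[OF h(1)])
         (auto simp: vector_scalar_mult_def intro!: continuous_intros)
    moreover have "poly uq t * h (w + t *s axis r 1) = poly up t" for t
      using h(2)[of "w + t *s axis r 1"] uq up by simp
    ultimately obtain u where u: "degree u \<le> degree up" "\<And>t. h (w + t *s axis r 1) = poly u t"
      using continuous_quotient_is_poly[of uq "\<lambda>t. h (w + t *s axis r 1)" up] by blast
    have "degree u \<le> D" using u(1) up(1) by simp
    have "h v = poly u (v $ r)" using u(2)[of "v $ r"] line self by simp
    also have "\<dots> = (\<Sum>k\<le>D. poly u (of_nat k) * poly (lagrange_basis D k) (v $ r))"
      by (subst lagrange_interpolation[OF \<open>degree u \<le> D\<close>]) (simp add: poly_sum)
    finally show "h v = (\<Sum>k\<le>D. h (coord_upd v r (of_nat k)) * poly (lagrange_basis D k) (v $ r))"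
      using u(2) line by simp
  qed
  thus ?thesis by (rule poly_fun_if_interpolates)
qed

text \<open>
  A holomorphic function is determined locally, so gluing suffices in the analytic case.  In the
  algebraic case the glued function is only locally a fraction; that it is one global
  fraction \<open>p / q\<close> is what the second hypothesis supplies.
\<close>
lemma is_regular_if_regular_germs:
  assumes reg: "\<And>y. regular_germ S y f" and mero: "S = Algebraic \<Longrightarrow> f \<in> mero Algebraic"
  shows "is_regular S f"
proof -
  obtain h where h: "mero_eq f h" "\<And>y. \<exists>r\<in>stalk S y. \<forall>\<^sub>F z in nhds y. h z = r z"
    using regular_germs_glue[OF reg] by blast
  have "h \<in> global_regular S"
  proof (cases S)
    case Analytic
    have "complex_differentiable_at h y" for y
    proof -
      obtain r U where r: "y \<in> U" "holomorphic_on_open U r" "\<forall>\<^sub>F z in nhds y. h z = r z"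
        using h(2)[of y] Analytic by auto
      obtain D where D: "(r has_derivative D) (at y)" "Vector_Spaces.linear (*s) (*) D"
        using r(1,2) unfolding holomorphic_on_open_def by blast
      have "\<forall>\<^sub>F z in nhds y. r z = h z" using r(3) by eventually_elim simp
      hence "(h has_derivative D) (at y)"
        using has_derivative_transform_eventually[OF D(1)]
          eventually_nhds_x_imp_x eventually_nhds_conv_at by blast
      thus ?thesis using D(2) unfolding complex_differentiable_at_def by blast
    qed
    thus ?thesis using Analytic by (simp add: holomorphic_on_open_iff)
  next
    case Algebraic
    have "isCont h y" for y
    proof -
      obtain r where r: "r \<in> stalk S y" "\<forall>\<^sub>F z in nhds y. h z = r z" using h(2)[of y] by blast
      have "isCont r y" using stalk_isCont_eventually[OF r(1)] by (rule eventually_nhds_x_imp_x)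
      thus ?thesis using isCont_cong[OF r(2)] by simp
    qed
    hence cont: "continuous_on UNIV h" by (simp add: continuous_at_imp_continuous_on)
    obtain p q where pq: "poly_fun p" "poly_fun q" "q \<noteq> (\<lambda>_. 0)" "mero_eq f (\<lambda>z. p z / q z)"
      using mero[OF Algebraic] by auto
    have nz: "h z = p z / q z" if "q z \<noteq> 0" for z
    proof (rule germ_eq_isCont)
      show "germ_eq z h (\<lambda>z. p z / q z)"
        using h(1) pq(4) germ_eq_trans germ_eq_sym unfolding mero_eq_def by blast
      show "isCont h z" by fact
      show "isCont (\<lambda>z. p z / q z) z"
        using that pq by (intro continuous_intros poly_fun_isCont) auto
    qed
    have pqc: "continuous_on UNIV p" "continuous_on UNIV q"
      using pq(1,2) by (simp_all add: continuous_at_imp_continuous_on poly_fun_isCont)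
    have "q z * h z = p z" for z
      by (rule dense_continuous_eq[OF poly_fun_nonzero_dense[OF pq(2,3)]
            continuous_on_mult[OF pqc(2) cont] pqc(1)]) (simp add: nz)
    hence "poly_fun h" using poly_fun_quotient[OF pq(1-3) cont] by blast
    thus ?thesis using Algebraic by simp
  qed
  thus ?thesis using h(1) unfolding is_regular_def by blast
qed

lemma mero_Algebraic_mult:
  assumes "poly_fun d" "f \<in> mero Algebraic"
  shows "(\<lambda>z. d z * f z) \<in> mero Algebraic"
proof -
  obtain p q where *: "poly_fun p" "poly_fun q" "q \<noteq> (\<lambda>_. 0)" "mero_eq f (\<lambda>z. p z / q z)"
    using assms(2) by auto
  have "germ_eq x (\<lambda>z. d z * f z) (\<lambda>z. d z * (p z / q z))" for x
    using *(4) by (intro germ_eq_mult germ_eq_refl) (simp add: mero_eq_def)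
  hence "mero_eq (\<lambda>z. d z * f z) (\<lambda>z. (d z * p z) / q z)" by (simp add: mero_eq_def)
  moreover have "poly_fun (\<lambda>z. d z * p z)" using assms(1) *(1) by (rule poly_fun.mult)
  ultimately show ?thesis using *(2,3) unfolding mero.simps by blast
qed

section \<open>Extracting one coefficient from its moments\<close>

text \<open>
  Multiplying by one more factor \<open>w\<^sub>l - u\<^sub>i\<close> raises the exponent of \<open>w\<^sub>l\<close> by one or contributes \<open>u\<^sub>i\<close>,
  which does not depend on \<open>l\<close> and leaves the sum: the Vandermonde system is eliminated one
  node at a time.
\<close>
lemma regular_germ_node_polynomial:
  assumes mom: "\<And>e. regular_germ S y (\<lambda>z. \<Sum>l\<in>I. B l z * w l z ^ e)"
    and "finite L" and u: "\<And>i. i \<in> L \<Longrightarrow> poly_fun (u i)"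
  shows "regular_germ S y (\<lambda>z. \<Sum>l\<in>I. B l z * w l z ^ e * (\<Prod>i\<in>L. w l z - u i z))"
  using assms(2) u
proof (induction L arbitrary: e rule: finite_induct)
  case empty
  thus ?case using mom by simp
next
  case (insert i L)
  let ?g = "\<lambda>e z. \<Sum>l\<in>I. B l z * w l z ^ e * (\<Prod>i\<in>L. w l z - u i z)"
  have "regular_germ S y (\<lambda>z. ?g (Suc e) z - u i z * ?g e z)"
    by (intro regular_germ_diff regular_germ_mult regular_germ_poly_fun insert.IH) (use insert in auto)
  moreover have "(\<Sum>l\<in>I. B l z * w l z ^ e * (\<Prod>i\<in>insert i L. w l z - u i z)) =
      ?g (Suc e) z - u i z * ?g e z" for z
    using insert(1,2) by (simp add: sum_distrib_left sum_subtractf[symmetric] algebra_simps)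
  ultimately show ?case by simp
qed

lemma regular_germ_cmult_cancel:
  assumes "regular_germ S y (\<lambda>z. c * f z)" "c \<noteq> 0"
  shows "regular_germ S y f"
proof -
  have "regular_germ S y (\<lambda>z. 1 / c * (c * f z))"
    by (rule regular_germ_mult[OF regular_germ_poly_fun assms(1)]) (rule poly_fun.const)
  thus ?thesis using assms(2) by simp
qed

text \<open>
  The sum defining the action runs over the shifts whose coefficient function is not literally
  zero.  Up to germ equality it may be taken over any finite set that contains all shifts
  contributing at \<open>y\<close>.
\<close>
lemma skew_apply_germ_eq:
  assumes "finite (skew_support A)" "finite N"
    and zero: "\<And>\<eta>. \<eta> \<notin> N \<Longrightarrow> germ_eq y (A \<eta>) (\<lambda>_. 0) \<or> F (y - \<eta>) = (\<lambda>_. 0)"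
  shows "germ_eq y (skew_apply A F y) (\<lambda>z. \<Sum>\<eta>\<in>N. A \<eta> z * F (y - \<eta>) (z - \<eta>))"
proof -
  let ?M = "skew_support A \<union> N" and ?t = "\<lambda>\<eta> z. A \<eta> z * F (y - \<eta>) (z - \<eta>)"
  have "skew_apply A F y = (\<lambda>z. \<Sum>\<eta>\<in>?M. ?t \<eta> z)"
    unfolding skew_apply_def using assms(1,2)
    by (intro ext sum.mono_neutral_left) (auto simp: skew_support_def)
  moreover have "germ_eq y (\<lambda>z. \<Sum>\<eta>\<in>?M. ?t \<eta> z) (\<lambda>z. \<Sum>\<eta>\<in>?M. if \<eta> \<in> N then ?t \<eta> z else 0)"
  proof (rule germ_eq_sum)
    fix \<eta>
    show "germ_eq y (?t \<eta>) (\<lambda>z. if \<eta> \<in> N then ?t \<eta> z else 0)"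
    proof (cases "\<eta> \<in> N")
      case False
      hence "germ_eq y (A \<eta>) (\<lambda>_. 0) \<or> F (y - \<eta>) = (\<lambda>_. 0)" by (rule zero)
      thus ?thesis using False germ_eq_mult[of y "A \<eta>" "\<lambda>_. 0", OF _ germ_eq_refl] by auto
    qed simp
  qed
  moreover have "(\<lambda>z. \<Sum>\<eta>\<in>?M. if \<eta> \<in> N then ?t \<eta> z else 0) = (\<lambda>z. \<Sum>\<eta>\<in>N. ?t \<eta> z)"
    using assms(1,2) by (intro ext sum.mono_neutral_cong_right) auto
  ultimately show ?thesis by simp
qed

section \<open>The action of the block permutations\<close>

locale block_permutations =
  fixes n :: nat and m :: "nat \<Rightarrow> nat" and pos :: "nat \<times> nat \<Rightarrow> 'i::finite"
  assumes bij_pos: "bij_betw pos (positions n m) UNIV"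
begin

abbreviation G :: "(nat \<Rightarrow> nat \<Rightarrow> nat) monoid" where "G \<equiv> perm_group n m"

abbreviation coord :: "complex ^ 'i \<Rightarrow> nat \<Rightarrow> nat \<Rightarrow> complex" where
  "coord v k i \<equiv> v $ pos (k, i)"

lemma group_G: "group G"
  unfolding perm_group_def by (simp add: sym_group_is_group)

lemma carrier_G: "carrier G = (\<Pi>\<^sub>E k\<in>{1..n}. {p. p permutes {1..m k}})"
  by (simp add: perm_group_def sym_group_def)

lemma permutes_G: "g \<in> carrier G \<Longrightarrow> k \<in> {1..n} \<Longrightarrow> g k permutes {1..m k}"
  unfolding carrier_G by blast

lemma finite_G: "finite (carrier G)"
  unfolding carrier_G by (intro finite_PiE) (auto intro: finite_permutations)

lemma inv_G: "g \<in> carrier G \<Longrightarrow> k \<in> {1..n} \<Longrightarrow> (inv\<^bsub>G\<^esub> g) k = Hilbert_Choice.inv (g k)"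
  using permutes_G[of g k]
  by (simp add: perm_group_def sym_group_is_group sym_group_carrier carrier_G[unfolded perm_group_def])

lemma mult_G: "k \<in> {1..n} \<Longrightarrow> (g \<otimes>\<^bsub>G\<^esub> h) k = g k \<circ> h k"
  by (simp add: perm_group_def sym_group_mult)

lemma pos_cases:
  obtains k i where "k \<in> {1..n}" "i \<in> {1..m k}" "q = pos (k, i)"
proof -
  have "q \<in> pos ` positions n m" using bij_pos by (auto simp: bij_betw_def)
  thus ?thesis using that by (auto simp: positions_def)
qed

lemma pos_eq_iff:
  assumes "k \<in> {1..n}" "i \<in> {1..m k}" "k' \<in> {1..n}" "i' \<in> {1..m k'}"
  shows "pos (k, i) = pos (k', i') \<longleftrightarrow> k = k' \<and> i = i'"
proof -
  have "inj_on pos (positions n m)" using bij_pos by (simp add: bij_betw_def)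
  from inj_on_eq_iff[OF this, of "(k, i)" "(k', i')"] show ?thesis
    using assms by (simp add: positions_def)
qed

lemma vec_eq_coord:
  assumes "\<And>k i. k \<in> {1..n} \<Longrightarrow> i \<in> {1..m k} \<Longrightarrow> coord v k i = coord w k i"
  shows "v = w"
proof -
  have "v $ q = w $ q" for q by (rule pos_cases[of q]) (use assms in simp)
  thus ?thesis by (simp add: vec_eq_iff)
qed

lemma coord_axis:
  assumes "k \<in> {1..n}" "i \<in> {1..m k}" "k' \<in> {1..n}" "i' \<in> {1..m k'}"
  shows "coord (axis (pos (k', i')) a) k i = (if k = k' \<and> i = i' then a else 0)"
  using pos_eq_iff[OF assms] by (auto simp: axis_def)

lemma coord_act:
  assumes "k \<in> {1..n}" "i \<in> {1..m k}"
  shows "coord (act n m pos g v) k i = coord v k (Hilbert_Choice.inv (g k) i)"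
proof -
  have "inv_into (positions n m) pos (pos (k, i)) = (k, i)"
    using bij_pos assms by (intro inv_into_f_f) (auto simp: bij_betw_def positions_def)
  thus ?thesis by (simp add: act_def)
qed

text \<open>The defining formula of the action without inverses; most arguments below use this form.\<close>
lemma coord_act_image:
  assumes "g \<in> carrier G" "k \<in> {1..n}" "i \<in> {1..m k}"
  shows "coord (act n m pos g v) k (g k i) = coord v k i"
proof -
  have "g k i \<in> {1..m k}" using permutes_G[OF assms(1,2)] assms(3) permutes_in_image by metis
  moreover have "Hilbert_Choice.inv (g k) (g k i) = i"
    using permutes_inverses(2)[OF permutes_G[OF assms(1,2)]] .
  ultimately show ?thesis using coord_act[OF assms(2)] by simp
qed

lemma coord_act_inv:
  assumes "g \<in> carrier G" "k \<in> {1..n}" "i \<in> {1..m k}"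
  shows "coord (act n m pos (inv\<^bsub>G\<^esub> g) v) k i = coord v k (g k i)"
  using coord_act[OF assms(2,3)] inv_G[OF assms(1,2)]
    inv_inv_eq[OF permutes_bij[OF permutes_G[OF assms(1,2)]]] by simp

lemma act_mult:
  assumes "g \<in> carrier G" "h \<in> carrier G"
  shows "act n m pos (g \<otimes>\<^bsub>G\<^esub> h) v = act n m pos g (act n m pos h v)"
proof (rule vec_eq_coord)
  fix k i assume ki: "k \<in> {1..n}" "i \<in> {1..m k}"
  note g = permutes_G[OF assms(1) ki(1)] and h = permutes_G[OF assms(2) ki(1)]
  have "Hilbert_Choice.inv (g k) i \<in> {1..m k}"
    using permutes_in_image[OF permutes_inv[OF g]] ki(2) by metis
  moreover have "Hilbert_Choice.inv (g k \<circ> h k) = Hilbert_Choice.inv (h k) \<circ> Hilbert_Choice.inv (g k)"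
    using g h by (intro o_inv_distrib) (auto intro: permutes_bij)
  ultimately show "coord (act n m pos (g \<otimes>\<^bsub>G\<^esub> h) v) k i = coord (act n m pos g (act n m pos h v)) k i"
    using ki by (simp add: coord_act mult_G)
qed

lemma act_one: "act n m pos \<one>\<^bsub>G\<^esub> v = v"
  by (rule vec_eq_coord) (simp add: coord_act perm_group_def sym_group_one)

lemma act_inv_act: "g \<in> carrier G \<Longrightarrow> act n m pos (inv\<^bsub>G\<^esub> g) (act n m pos g v) = v"
  using act_mult[of "inv\<^bsub>G\<^esub> g" g v] act_one group.inv_closed[OF group_G] group.l_inv[OF group_G] by simp

text \<open>
  The invariants that separate orbits: with \<open>f\<close> the identity this is the sum of a block, with
  \<open>f\<close> the indicator of a value it is the multiplicity of that value in the block.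
\<close>
lemma block_sum_act:
  fixes f :: "complex \<Rightarrow> 'b::comm_monoid_add"
  assumes "g \<in> carrier G" "k \<in> {1..n}"
  shows "(\<Sum>i\<in>{1..m k}. f (coord (act n m pos g v) k i)) = (\<Sum>i\<in>{1..m k}. f (coord v k i))"
proof -
  have "(\<Sum>i\<in>{1..m k}. f (coord (act n m pos g v) k i)) =
    (\<Sum>i\<in>{1..m k}. f (coord (act n m pos g v) k (g k i)))"
    using sum.permute[OF permutes_G[OF assms]] by (simp add: o_def)
  also have "\<dots> = (\<Sum>i\<in>{1..m k}. f (coord v k i))"
    using coord_act_image[OF assms] by (intro sum.cong) auto
  finally show ?thesis .
qed

definition orbit :: "complex ^ 'i \<Rightarrow> (complex ^ 'i) set" where
  "orbit x = (\<lambda>g. act n m pos g x) ` carrier G"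

lemma finite_orbit: "finite (orbit x)"
  unfolding orbit_def using finite_G by simp

lemma orbit_refl: "x \<in> orbit x"
  unfolding orbit_def using act_one[of x] group.is_monoid[OF group_G] monoid.one_closed by force

lemma act_in_orbit:
  assumes "g \<in> carrier G" "w \<in> orbit x" shows "act n m pos g w \<in> orbit x"
proof -
  obtain h where "h \<in> carrier G" "w = act n m pos h x" using assms(2) unfolding orbit_def by blast
  hence "act n m pos g w = act n m pos (g \<otimes>\<^bsub>G\<^esub> h) x" "g \<otimes>\<^bsub>G\<^esub> h \<in> carrier G"
    using act_mult assms(1) monoid.m_closed[OF group.is_monoid[OF group_G]] by auto
  thus ?thesis unfolding orbit_def by blast
qed

lemma act_in_orbit_iff:
  assumes "g \<in> carrier G" shows "act n m pos g w \<in> orbit x \<longleftrightarrow> w \<in> orbit x"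
  using act_in_orbit[OF assms] act_in_orbit[OF group.inv_closed[OF group_G assms], of "act n m pos g w" x]
    act_inv_act[OF assms] by auto

lemma block_sum_orbit:
  fixes f :: "complex \<Rightarrow> 'b::comm_monoid_add"
  assumes "w \<in> orbit x" "k \<in> {1..n}"
  shows "(\<Sum>i\<in>{1..m k}. f (coord w k i)) = (\<Sum>i\<in>{1..m k}. f (coord x k i))"
  using assms block_sum_act unfolding orbit_def by blast

lemma block_count_orbit:
  assumes "w \<in> orbit x" "k \<in> {1..n}"
  shows "card {i\<in>{1..m k}. coord w k i = b} = card {i\<in>{1..m k}. coord x k i = b}"
  using block_sum_orbit[OF assms, of "\<lambda>t. if t = b then 1 else 0 :: nat"]
  by (simp add: card_eq_sum sum.inter_filter[symmetric] del: sum_constant)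

text \<open>
  Block sums determine block and length of a nonzero shift.  For the position, count how often
  \<open>y\<^sub>k\<^sub>j\<close> occurs in block \<open>k\<close>: subtracting \<open>a \<noteq> 0\<close> at \<open>j\<close> destroys one occurrence, and subtracting
  it at \<open>j'\<close> does so only if \<open>y\<^sub>k\<^sub>j\<^sub>' = y\<^sub>k\<^sub>j\<close>.
\<close>
lemma shifts_in_one_orbit:
  assumes k: "k \<in> {1..n}" "j \<in> {1..m k}" and k': "k' \<in> {1..n}" "j' \<in> {1..m k'}"
    and orb: "y - axis (pos (k', j')) b \<in> orbit (y - axis (pos (k, j)) a)"
  shows "axis (pos (k', j')) b = axis (pos (k, j)) a \<or>
    k' = k \<and> b = a \<and> coord y k j' = coord y k j"
proof -
  have blk: "(\<Sum>i\<in>{1..m l}. coord (y - axis (pos (k0, j0)) c) l i) =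
      (\<Sum>i\<in>{1..m l}. coord y l i) - (if l = k0 then c else 0)"
    if "l \<in> {1..n}" "k0 \<in> {1..n}" "j0 \<in> {1..m k0}" for l k0 j0 c
  proof -
    have "(\<Sum>i\<in>{1..m l}. coord (axis (pos (k0, j0)) c) l i) =
        (\<Sum>i\<in>{1..m l}. if i = j0 then if l = k0 then c else 0 else 0)"
      using that by (intro sum.cong) (auto simp: coord_axis)
    also have "\<dots> = (if l = k0 then c else 0)" using that by auto
    finally show ?thesis by (simp add: sum_subtractf)
  qed
  have sums: "(if l = k' then b else 0) = (if l = k then a else 0)" if "l \<in> {1..n}" for l
    using block_sum_orbit[OF orb that, of "\<lambda>t. t"] blk[OF that k] blk[OF that k'] by simp
  show ?thesis
  proof (cases "a = 0")
    case True
    hence "b = 0" using sums[OF k'(1)] by (auto split: if_splits)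
    thus ?thesis using True by (simp add: axis_def vec_eq_iff)
  next
    case False
    hence kb: "k' = k" "b = a" using sums[OF k(1)] by (auto split: if_splits)
    define c where "c = coord y k j"
    let ?J = "{i\<in>{1..m k}. coord y k i = c}"
    have "coord y k j' = c"
    proof (rule ccontr)
      assume ne: "coord y k j' \<noteq> c"
      have "{i\<in>{1..m k}. coord (y - axis (pos (k, j)) a) k i = c} = ?J - {j}"
        using False k by (auto simp: coord_axis c_def split: if_splits)
      moreover have "?J \<subseteq> {i\<in>{1..m k}. coord (y - axis (pos (k', j')) b) k i = c}"
        using ne k k' kb by (auto simp: coord_axis)
      hence "card ?J \<le> card {i\<in>{1..m k}. coord (y - axis (pos (k', j')) b) k i = c}"
        by (intro card_mono) auto
      ultimately have "card ?J \<le> card (?J - {j})"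
        using block_count_orbit[OF orb k(1), of c] by simp
      moreover have "card (?J - {j}) < card ?J"
        using k(2) by (intro psubset_card_mono) (auto simp: c_def)
      ultimately show False by simp
    qed
    thus ?thesis using kb by (simp add: c_def)
  qed
qed

text \<open>The restriction to \<open>{1..n}\<close> makes this an element of the product group, whose carrier is extensional.\<close>
definition swap :: "nat \<Rightarrow> nat \<Rightarrow> nat \<Rightarrow> nat \<Rightarrow> nat \<Rightarrow> nat" where
  "swap k j l = (\<lambda>k'\<in>{1..n}. if k' = k then Transposition.transpose j l else id)"

lemma swap_in_G:
  assumes "j \<in> {1..m k}" "l \<in> {1..m k}" shows "swap k j l \<in> carrier G"
  unfolding carrier_G swap_def using assms by (auto simp: permutes_id intro!: permutes_swap_id)

lemma coord_act_swap:
  assumes "k' \<in> {1..n}" "i \<in> {1..m k'}" "j \<in> {1..m k}" "l \<in> {1..m k}"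
  shows "coord (act n m pos (swap k j l) v) k' i =
    coord v k' (if k' = k then Transposition.transpose j l i else i)"
  using assms(1) coord_act[OF assms(1,2)] by (auto simp: swap_def)

lemma shift_in_orbit:
  assumes k: "k \<in> {1..n}" "j \<in> {1..m k}" "l \<in> {1..m k}" and eq: "coord y k l = coord y k j"
  shows "y - axis (pos (k, l)) a \<in> orbit (y - axis (pos (k, j)) a)"
proof -
  have "y - axis (pos (k, l)) a = act n m pos (swap k j l) (y - axis (pos (k, j)) a)"
  proof (rule vec_eq_coord)
    fix k' i assume k': "k' \<in> {1..n}" "i \<in> {1..m k'}"
    show "coord (y - axis (pos (k, l)) a) k' i =
        coord (act n m pos (swap k j l) (y - axis (pos (k, j)) a)) k' i"
      unfolding coord_act_swap[OF k' k(2,3)]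
      using k k' eq by (auto simp: coord_axis Transposition.transpose_def)
  qed
  thus ?thesis unfolding orbit_def using swap_in_G[OF k(2,3)] by blast
qed

text \<open>
  The sum runs over the positions where the base point \<open>w\<close>, not the variable \<open>z\<close>, has the value
  \<open>c\<close>.  The germ at \<open>w\<close> is thus a polynomial invariant under the stabiliser of \<open>w\<close>, even when
  that stabiliser moves the position that a shift acts on, and it is transported along the orbit correctly.
\<close>
definition power_sum_germs ::
  "complex ^ 'i \<Rightarrow> nat \<Rightarrow> complex \<Rightarrow> nat \<Rightarrow> complex ^ 'i \<Rightarrow> complex ^ 'i \<Rightarrow> complex" where
  "power_sum_germs x k c e w =
    (if w \<in> orbit x then (\<lambda>z. \<Sum>i\<in>{1..m k}. if coord w k i = c then coord z k i ^ e else 0)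
     else (\<lambda>_. 0))"

lemma power_sum_germs_invariant:
  assumes k: "k \<in> {1..n}"
  shows "power_sum_germs x k c e \<in> invariant_germs S n m pos"
proof -
  have "poly_fun (power_sum_germs x k c e w)" for w
  proof -
    have "poly_fun (\<lambda>z. if coord w k i = c then coord z k i ^ e else 0)" for i
      by (cases "coord w k i = c") (auto intro: poly_fun_power poly_fun.intros)
    thus ?thesis unfolding power_sum_germs_def
      by (auto intro: poly_fun_sum poly_fun.const)
  qed
  hence "\<forall>w. power_sum_germs x k c e w \<in> stalk S w" using stalk_poly_fun by blast
  moreover have "finite {w. \<not> germ_eq w (power_sum_germs x k c e w) (\<lambda>_. 0)}"
    by (rule finite_subset[OF _ finite_orbit[of x]]) (auto simp: power_sum_germs_def)
  moreover have "power_sum_germs x k c e (act n m pos g w) =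
      act_fun n m pos g (power_sum_germs x k c e w)" if g: "g \<in> carrier G" for g w
  proof
    fix z
    let ?t = "\<lambda>i. if coord (act n m pos g w) k i = c then coord z k i ^ e else 0"
    have "(\<Sum>i\<in>{1..m k}. ?t i) = (\<Sum>i\<in>{1..m k}. ?t (g k i))"
      using sum.permute[OF permutes_G[OF g k], of ?t] by (simp add: o_def)
    also have "\<dots> = (\<Sum>i\<in>{1..m k}. if coord w k i = c
        then coord (act n m pos (inv\<^bsub>G\<^esub> g) z) k i ^ e else 0)"
      by (intro sum.cong refl) (simp only: coord_act_image[OF g k] coord_act_inv[OF g k])
    finally show "power_sum_germs x k c e (act n m pos g w) z =
        act_fun n m pos g (power_sum_germs x k c e w) z"
      using act_in_orbit_iff[OF g, of w x] by (simp add: power_sum_germs_def act_fun_def)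
  qed
  ultimately show ?thesis unfolding invariant_germs_def by simp
qed

section \<open>Reflections, the sign character and its semi-invariant\<close>

definition sign_char :: "(nat \<Rightarrow> nat \<Rightarrow> nat) \<Rightarrow> complex" where
  "sign_char g = (\<Prod>k\<in>{1..n}. of_int (sign (g k)))"

lemma sign_char_hom: "sign_char \<in> hom G nonzero_complex"
proof (rule homI)
  fix g assume "g \<in> carrier G"
  show "sign_char g \<in> carrier nonzero_complex"
    by (simp add: sign_char_def nonzero_complex_def)
next
  fix g h assume gh: "g \<in> carrier G" "h \<in> carrier G"
  have "permutation (g k)" "permutation (h k)" if "k \<in> {1..n}" for k
    using permutes_G[OF gh(1) that] permutes_G[OF gh(2) that] permutation_permutes by blast+
  thus "sign_char (g \<otimes>\<^bsub>G\<^esub> h) = sign_char g \<otimes>\<^bsub>nonzero_complex\<^esub> sign_char h"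
    by (simp add: sign_char_def nonzero_complex_def mult_G sign_compose prod.distrib)
qed

definition mirror :: "nat \<Rightarrow> nat \<Rightarrow> nat \<Rightarrow> (complex ^ 'i) set" where
  "mirror k j l = {v. coord v k j = coord v k l}"

lemma fixed_space_swap:
  assumes k: "k \<in> {1..n}" "j \<in> {1..m k}" "l \<in> {1..m k}"
  shows "{v. act n m pos (swap k j l) v = v} = mirror k j l"
proof (intro equalityI subsetI)
  fix v assume "v \<in> {v. act n m pos (swap k j l) v = v}"
  hence "coord v k j = coord (act n m pos (swap k j l) v) k j" by simp
  also have "\<dots> = coord v k l" using coord_act_swap[OF k(1,2) k(2,3)] by simp
  finally show "v \<in> mirror k j l" by (simp add: mirror_def)
next
  fix v assume v: "v \<in> mirror k j l"
  have "act n m pos (swap k j l) v = v"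
  proof (rule vec_eq_coord)
    fix k' i assume k': "k' \<in> {1..n}" "i \<in> {1..m k'}"
    show "coord (act n m pos (swap k j l) v) k' i = coord v k' i"
      using v unfolding coord_act_swap[OF k' k(2,3)] mirror_def
      by (auto simp: Transposition.transpose_def)
  qed
  thus "v \<in> {v. act n m pos (swap k j l) v = v}" by simp
qed

lemma is_reflection_swap:
  assumes k: "k \<in> {1..n}" "j \<in> {1..m k}" "l \<in> {1..m k}" and ne: "j \<noteq> l"
  shows "is_reflection n m pos (mirror k j l) (swap k j l)"
proof -
  let ?f = "\<lambda>v. coord v k j - coord v k l"
  have "Vector_Spaces.linear (*s) (*) ?f" by (simp add: complex_linear_iff algebra_simps)
  moreover have "?f (axis (pos (k, j)) 1) = 1" using k ne by (simp add: coord_axis)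
  hence "?f \<noteq> (\<lambda>_. 0)" by (metis one_neq_zero)
  ultimately have "is_hyperplane_form (mirror k j l) ?f"
    by (auto simp: is_hyperplane_form_def mirror_def)
  thus ?thesis
    using swap_in_G[OF k(2,3)] fixed_space_swap[OF k] unfolding is_reflection_def by blast
qed

text \<open>
  Test on a vector \<open>v\<close> whose coordinates are distinct except for the two that define the mirror.
  Since \<open>g\<close> fixes \<open>v\<close>, it can move only these two positions, and it does move them because it
  does not fix all of \<open>V\<close>.
\<close>
lemma reflection_unique:
  assumes k: "k \<in> {1..n}" "j \<in> {1..m k}" "l \<in> {1..m k}" and ne: "j \<noteq> l"
    and g: "is_reflection n m pos (mirror k j l) g"
  shows "g = swap k j l"
proof -
  have gG: "g \<in> carrier G" and fixed: "\<And>v. act n m pos g v = v \<longleftrightarrow> v \<in> mirror k j l"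
    using g unfolding is_reflection_def by auto
  obtain c :: "'i \<Rightarrow> nat" where c: "inj c"
    using finite_imp_inj_to_nat_seg[of "UNIV :: 'i set"] by auto
  define v :: "complex ^ 'i" where
    "v = (\<chi> q. of_nat (c (if q = pos (k, l) then pos (k, j) else q)))"
  have "v \<in> mirror k j l" by (simp add: v_def mirror_def)
  hence gv: "act n m pos g v = v" using fixed by blast
  have img: "g k' i \<in> {1..m k'}" if "k' \<in> {1..n}" "i \<in> {1..m k'}" for k' i
    using permutes_in_image[OF permutes_G[OF gG that(1)]] that(2) by blast
  have near: "g k' i = i \<or> k' = k \<and> i \<in> {j, l} \<and> g k' i \<in> {j, l}"
    if ki: "k' \<in> {1..n}" "i \<in> {1..m k'}" for k' i
  proof -
    have "coord v k' (g k' i) = coord v k' i" using coord_act_image[OF gG ki, of v] gv by simp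
    hence "(if pos (k', g k' i) = pos (k, l) then pos (k, j) else pos (k', g k' i)) =
        (if pos (k', i) = pos (k, l) then pos (k, j) else pos (k', i))"
      using c by (simp add: v_def inj_eq)
    thus ?thesis
      using pos_eq_iff ki img[OF ki] k by (auto split: if_splits)
  qed
  have "g k j \<noteq> j"
  proof
    assume gj: "g k j = j"
    have inj: "inj (g k)" using permutes_inj[OF permutes_G[OF gG k(1)]] .
    have "g k l = l" using near[OF k(1,3)] gj inj_eq[OF inj, of l j] ne by auto
    hence "g k' i = i" if "k' \<in> {1..n}" "i \<in> {1..m k'}" for k' i using near[OF that] gj by auto
    hence "act n m pos g w = w" for w
      using coord_act_image[OF gG, of _ _ w] by (intro vec_eq_coord) metis
    hence "axis (pos (k, j)) 1 \<in> mirror k j l" using fixed by blast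
    thus False using k ne by (simp add: mirror_def coord_axis)
  qed
  hence gj: "g k j = l" using near[OF k(1,2)] by auto
  have gl: "g k l = j"
    using near[OF k(1,3)] gj ne inj_eq[OF permutes_inj[OF permutes_G[OF gG k(1)]], of l j] by auto
  have "g k' = swap k j l k'" if k': "k' \<in> {1..n}" for k'
  proof
    fix i
    show "g k' i = swap k j l k' i"
    proof (cases "i \<in> {1..m k'}")
      case True
      thus ?thesis using near[OF k' True] gj gl k'
        by (auto simp: swap_def Transposition.transpose_def)
    next
      case False
      hence "g k' i = i" using permutes_not_in[OF permutes_G[OF gG k']] by blast
      thus ?thesis using False k k' by (auto simp: swap_def Transposition.transpose_def)
    qed
  qed
  thus ?thesis
    using gG swap_in_G[OF k(2,3)] unfolding carrier_G by (intro PiE_ext) auto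
qed

lemma hyperplane_refl_mirror:
  assumes "k \<in> {1..n}" "j \<in> {1..m k}" "l \<in> {1..m k}" "j \<noteq> l"
  shows "hyperplane_refl n m pos (mirror k j l) = swap k j l"
  unfolding hyperplane_refl_def
  using is_reflection_swap[OF assms] reflection_unique[OF assms] by (rule some_equality)

lemma sign_char_swap:
  assumes "k \<in> {1..n}" "j \<noteq> l"
  shows "sign_char (swap k j l) = -1"
proof -
  have "sign_char (swap k j l) = (\<Prod>k'\<in>{1..n}. if k' = k then -1 else 1)"
    unfolding sign_char_def using assms(2)
    by (intro prod.cong) (auto simp: swap_def sign_swap_id)
  thus ?thesis using assms(1) by simp
qed

lemma det_swap:
  assumes k: "k \<in> {1..n}" "j \<in> {1..m k}" "l \<in> {1..m k}" and ne: "j \<noteq> l"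
  shows "det (matrix (act n m pos (swap k j l))) = -1"
proof -
  let ?p = "Transposition.transpose (pos (k, j)) (pos (k, l))"
  have act: "act n m pos (swap k j l) v = (\<chi> q. v $ ?p q)" for v
  proof (rule vec_eq_coord)
    fix k' i assume k': "k' \<in> {1..n}" "i \<in> {1..m k'}"
    show "coord (act n m pos (swap k j l) v) k' i = coord (\<chi> q. v $ ?p q) k' i"
      unfolding coord_act_swap[OF k' k(2,3)]
      using pos_eq_iff[OF k' k(1,2)] pos_eq_iff[OF k' k(1,3)]
      by (auto simp: Transposition.transpose_def)
  qed
  have "matrix (act n m pos (swap k j l)) = (\<chi> q. mat 1 $ ?p q)"
    by (simp add: vec_eq_iff matrix_def act mat_def axis_def)
  hence "det (matrix (act n m pos (swap k j l))) = of_int (sign ?p)"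
    by (simp add: det_permute_rows permutes_swap_id det_I)
  also have "\<dots> = -1" using pos_eq_iff[OF k(1,2) k(1,3)] ne by (simp add: sign_swap_id)
  finally show ?thesis .
qed

text \<open>Character and determinant are both \<open>-1\<close> on the reflection, while the exponent \<open>0\<close> gives \<open>1\<close>.\<close>
lemma a_exp_sign_char:
  assumes "k \<in> {1..n}" "j \<in> {1..m k}" "l \<in> {1..m k}" "j \<noteq> l"
  shows "a_exp n m pos sign_char (mirror k j l) = 1"
  unfolding a_exp_def hyperplane_refl_mirror[OF assms] sign_char_swap[OF assms(1,4)]
    det_transpose det_swap[OF assms]
proof (rule Least_equality)
  fix e :: nat assume "- 1 = (- 1 :: complex) ^ e"
  thus "1 \<le> e" by (cases e) auto
qed simp

lemma finite_refl_hyperplanes: "finite (refl_hyperplanes n m pos)"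
proof (rule finite_subset)
  show "refl_hyperplanes n m pos \<subseteq> (\<lambda>g. {v. act n m pos g v = v}) ` carrier G"
    by (auto simp: refl_hyperplanes_def is_reflection_def)
qed (use finite_G in simp)

text \<open>Subtracting a multiple of one basis vector moves \<open>v\<close> into the mirror, where the form vanishes.\<close>
lemma hyperplane_form_mirror:
  assumes k: "k \<in> {1..n}" "j \<in> {1..m k}" "l \<in> {1..m k}" "j \<noteq> l"
    and h: "is_hyperplane_form (mirror k j l) h"
  shows "h v = h (axis (pos (k, j)) 1) * (coord v k j - coord v k l)"
proof -
  define c where "c = coord v k j - coord v k l"
  have lin: "h (x + y) = h x + h y" "h (b *s x) = b * h x" for x y b
    using h by (simp_all add: is_hyperplane_form_def complex_linear_iff)
  have "v - c *s axis (pos (k, j)) 1 \<in> mirror k j l"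
    using k by (simp add: mirror_def coord_axis c_def)
  hence "h (v - c *s axis (pos (k, j)) 1) = 0" using h by (simp add: is_hyperplane_form_def)
  moreover have "h v = h (v - c *s axis (pos (k, j)) 1) + h (c *s axis (pos (k, j)) 1)"
    using lin(1)[of "v - c *s axis (pos (k, j)) 1" "c *s axis (pos (k, j)) 1"] by simp
  ultimately have "h v = c * h (axis (pos (k, j)) 1)" by (simp add: lin(2))
  thus ?thesis by (simp add: c_def)
qed

lemma poly_fun_d_char:
  assumes "\<And>H. H \<in> refl_hyperplanes n m pos \<Longrightarrow> is_hyperplane_form H (\<gamma> H)"
  shows "poly_fun (d_char n m pos \<gamma> ch)"
  unfolding d_char_def
  by (intro poly_fun_prod poly_fun_power poly_fun_complex_linear)
     (use assms in \<open>auto simp: is_hyperplane_form_def\<close>)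

text \<open>
  The mirrors \<open>z\<^sub>k\<^sub>j = z\<^sub>k\<^sub>l\<close> for \<open>l \<in> J\<close> are distinct and occur in \<open>d\<close> with exponent \<open>1\<close>.  The cofactor
  \<open>R\<close> collects the other hyperplanes and the constants by which the chosen linear forms differ from
  \<open>z\<^sub>k\<^sub>j - z\<^sub>k\<^sub>l\<close>.
\<close>
lemma d_char_sign_factor:
  assumes forms: "\<And>H. H \<in> refl_hyperplanes n m pos \<Longrightarrow> is_hyperplane_form H (\<gamma> H)"
    and k: "k \<in> {1..n}" "j \<in> {1..m k}" and J: "J \<subseteq> {1..m k} - {j}"
  obtains R where "poly_fun R"
    "\<And>z. d_char n m pos \<gamma> sign_char z = R z * (\<Prod>l\<in>J. coord z k j - coord z k l)"
proof -
  let ?H = "refl_hyperplanes n m pos" and ?e = "a_exp n m pos sign_char"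
  let ?M = "mirror k j ` J"
  have l: "l \<in> {1..m k}" "j \<noteq> l" if "l \<in> J" for l using J that by auto
  have M: "?M \<subseteq> ?H"
    using is_reflection_swap[OF k] l unfolding refl_hyperplanes_def by blast
  have inj: "inj_on (mirror k j) J"
  proof (rule inj_onI, rule ccontr)
    fix l l' assume *: "l \<in> J" "l' \<in> J" "mirror k j l = mirror k j l'" "l \<noteq> l'"
    have "axis (pos (k, l')) 1 \<in> mirror k j l" "axis (pos (k, l')) 1 \<notin> mirror k j l'"
      using k l[OF *(1)] l[OF *(2)] *(4) by (auto simp: mirror_def coord_axis)
    thus False using *(3) by blast
  qed
  define R where "R z = (\<Prod>H\<in>?H - ?M. \<gamma> H z ^ ?e H) *
    (\<Prod>l\<in>J. \<gamma> (mirror k j l) (axis (pos (k, j)) 1))" for z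
  have "poly_fun R" unfolding R_def
    by (intro poly_fun.mult poly_fun.const poly_fun_prod poly_fun_power poly_fun_complex_linear)
       (use forms in \<open>auto simp: is_hyperplane_form_def\<close>)
  moreover have "d_char n m pos \<gamma> sign_char z = R z * (\<Prod>l\<in>J. coord z k j - coord z k l)" for z
  proof -
    have "(\<Prod>H\<in>?M. \<gamma> H z ^ ?e H) = (\<Prod>l\<in>J. \<gamma> (mirror k j l) z)"
      using a_exp_sign_char[OF k] l by (subst prod.reindex[OF inj]) (auto intro!: prod.cong)
    also have "\<dots> = (\<Prod>l\<in>J. \<gamma> (mirror k j l) (axis (pos (k, j)) 1) * (coord z k j - coord z k l))"
    proof (rule prod.cong[OF refl])
      fix i assume i: "i \<in> J"
      have "is_hyperplane_form (mirror k j i) (\<gamma> (mirror k j i))" using forms M i by blast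
      from hyperplane_form_mirror[OF k l[OF i] this]
      show "\<gamma> (mirror k j i) z =
        \<gamma> (mirror k j i) (axis (pos (k, j)) 1) * (coord z k j - coord z k i)" .
    qed
    finally have "(\<Prod>H\<in>?M. \<gamma> H z ^ ?e H) =
      (\<Prod>l\<in>J. \<gamma> (mirror k j l) (axis (pos (k, j)) 1)) * (\<Prod>l\<in>J. coord z k j - coord z k l)"
      by (simp add: prod.distrib)
    thus ?thesis
      unfolding d_char_def R_def prod.subset_diff[OF M finite_refl_hyperplanes] by simp
  qed
  ultimately show ?thesis using that by blast
qed

section \<open>Poles of the coefficients\<close>

text \<open>
  The image of a test family at \<open>y\<close> is regular because \<open>A\<close> preserves invariant germs; it
  receives contributions only from the shifts that carry the orbit of \<open>x\<close> to \<open>y\<close>.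
\<close>
lemma regular_applied_power_sum_germs:
  assumes pres: "preserves_invariant_germs S n m pos A" and k: "k \<in> {1..n}"
    and "finite (skew_support A)" "finite N"
    and "\<And>\<eta>. \<eta> \<notin> N \<Longrightarrow> germ_eq y (A \<eta>) (\<lambda>_. 0) \<or> y - \<eta> \<notin> orbit x"
  shows "regular_germ S y
    (\<lambda>z. \<Sum>\<eta>\<in>N. A \<eta> z * power_sum_germs x k c e (y - \<eta>) (z - \<eta>))"
proof -
  let ?F = "power_sum_germs x k c e"
  obtain F' where "F' \<in> invariant_germs S n m pos" "germ_eq y (skew_apply A ?F y) (F' y)"
    using pres power_sum_germs_invariant[OF k] unfolding preserves_invariant_germs_def by blast
  hence "regular_germ S y (skew_apply A ?F y)"
    unfolding regular_germ_def invariant_germs_def by blast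
  moreover have "germ_eq y (skew_apply A ?F y) (\<lambda>z. \<Sum>\<eta>\<in>N. A \<eta> z * ?F (y - \<eta>) (z - \<eta>))"
  proof (rule skew_apply_germ_eq[OF assms(3,4)])
    fix \<eta> assume "\<eta> \<notin> N"
    from assms(5)[OF this] show "germ_eq y (A \<eta>) (\<lambda>_. 0) \<or> ?F (y - \<eta>) = (\<lambda>_. 0)"
      by (auto simp: power_sum_germs_def)
  qed
  ultimately show ?thesis using regular_germ_cong germ_eq_sym by blast
qed

text \<open>
  The pole bound.  For \<open>a = 0\<close> the test family on the orbit of \<open>y\<close> with exponent \<open>0\<close> is a nonzero
  constant, and only the zero shift contributes, so the coefficient itself is regular.  For
  \<open>a \<noteq> 0\<close> the contributing shifts are those at the positions \<open>J\<close> with \<open>y\<^sub>k\<^sub>l = y\<^sub>k\<^sub>j\<close>; their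
  coefficients \<open>B\<^sub>l\<close> are separated by means of their moments.
\<close>
lemma regular_germ_coefficient:
  assumes pres: "preserves_invariant_germs S n m pos A" and fin: "finite (skew_support A)"
    and supp: "\<And>\<eta>. (\<nexists>k i b. k \<in> {1..n} \<and> i \<in> {1..m k} \<and> \<eta> = axis (pos (k, i)) b) \<Longrightarrow>
      germ_eq y (A \<eta>) (\<lambda>_. 0)"
    and k: "k \<in> {1..n}" "j \<in> {1..m k}"
  shows "regular_germ S y (\<lambda>z. A (axis (pos (k, j)) a) z *
    (\<Prod>l\<in>{l\<in>{1..m k} - {j}. coord y k l = coord y k j}. coord z k j - coord z k l))"
proof (cases "a = 0")
  case True
  hence axis: "axis (pos (k, j)) a = 0" by (simp add: axis_def vec_eq_iff)
  define c where "c = coord y k j"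
  let ?J = "{i\<in>{1..m k}. coord y k i = c}"
  have "regular_germ S y (\<lambda>z. \<Sum>\<eta>\<in>{0}. A \<eta> z * power_sum_germs y k c 0 (y - \<eta>) (z - \<eta>))"
  proof (rule regular_applied_power_sum_germs[OF pres k(1) fin])
    fix \<eta> :: "complex ^ 'i" assume "\<eta> \<notin> {0}"
    show "germ_eq y (A \<eta>) (\<lambda>_. 0) \<or> y - \<eta> \<notin> orbit y"
    proof (rule ccontr)
      assume *: "\<not> ?thesis"
      then obtain k' i b where k': "k' \<in> {1..n}" "i \<in> {1..m k'}" "\<eta> = axis (pos (k', i)) b"
        using supp by blast
      have "y - axis (pos (k', i)) b \<in> orbit (y - axis (pos (k, j)) a)"
        unfolding axis k'(3)[symmetric] using * by simp
      from shifts_in_one_orbit[OF k k'(1,2) this] have "axis (pos (k', i)) b = 0"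
      proof
        assume "axis (pos (k', i)) b = axis (pos (k, j)) a"
        thus ?thesis using axis by metis
      qed (simp add: True)
      hence "\<eta> = 0" using k'(3) by metis
      thus False using \<open>\<eta> \<notin> {0}\<close> by simp
    qed
  qed simp
  moreover have "power_sum_germs y k c 0 y z = of_nat (card ?J)" for z
    using orbit_refl[of y] by (simp add: power_sum_germs_def sum.inter_filter[symmetric])
  ultimately have "regular_germ S y (\<lambda>z. of_nat (card ?J) * A 0 z)"
    by (simp add: mult.commute)
  moreover have "card ?J \<noteq> 0" using k(2) by (auto simp: c_def)
  ultimately have "regular_germ S y (A 0)" using regular_germ_cmult_cancel[of S y "of_nat (card ?J)" "A 0"] by simp
  thus ?thesis unfolding axis
    by (rule regular_germ_mult[OF _ regular_germ_poly_fun])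
       (intro poly_fun_prod poly_fun_diff poly_fun.coord)
next
  case False
  define J where "J = {l\<in>{1..m k}. coord y k l = coord y k j}"
  define c where "c = coord y k j - a"
  define x where "x = y - axis (pos (k, j)) a"
  define B where "B l = A (axis (pos (k, l)) a)" for l
  define s where "s e z = (\<Sum>i\<in>{1..m k}. if coord y k i = c then coord z k i ^ e else 0)" for e z
  have J: "finite J" "j \<in> J" "\<And>l. l \<in> J \<Longrightarrow> l \<in> {1..m k} \<and> coord y k l = coord y k j"
    using k by (auto simp: J_def)
  have inj: "inj_on (\<lambda>l. axis (pos (k, l)) a) J"
  proof (rule inj_onI)
    fix l l' assume l: "l \<in> J" "l' \<in> J" and eq: "axis (pos (k, l)) a = axis (pos (k, l')) a"
    have "pos (k, l) = pos (k, l')" using eq False by (auto simp: axis_eq_axis)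
    thus "l = l'" using pos_eq_iff[of k l k l'] k(1) J(3)[OF l(1)] J(3)[OF l(2)] by simp
  qed
  have moment: "regular_germ S y (\<lambda>z. \<Sum>l\<in>J. B l z * ((coord z k l - a) ^ e + s e z))" for e
  proof -
    let ?N = "(\<lambda>l. axis (pos (k, l)) a) ` J"
    have "regular_germ S y (\<lambda>z. \<Sum>\<eta>\<in>?N. A \<eta> z * power_sum_germs x k c e (y - \<eta>) (z - \<eta>))"
    proof (rule regular_applied_power_sum_germs[OF pres k(1) fin])
      fix \<eta> assume \<eta>: "\<eta> \<notin> ?N"
      show "germ_eq y (A \<eta>) (\<lambda>_. 0) \<or> y - \<eta> \<notin> orbit x"
      proof (rule ccontr)
        assume *: "\<not> ?thesis"
        then obtain k' i b where k': "k' \<in> {1..n}" "i \<in> {1..m k'}" "\<eta> = axis (pos (k', i)) b"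
          using supp by blast
        hence "y - axis (pos (k', i)) b \<in> orbit (y - axis (pos (k, j)) a)"
          using * by (simp add: x_def)
        from shifts_in_one_orbit[OF k k'(1,2) this] show False
          using \<eta> k' J(2) by (auto simp: J_def)
      qed
    qed (use J(1) in simp)
    \<comment> \<open>The shifted point has the value \<open>c\<close> at \<open>l\<close> and where \<open>y\<close> has it; as \<open>a \<noteq> 0\<close>, \<open>y\<close> does not
      have it at \<open>l\<close>, so \<open>s e z\<close> is the same for every \<open>l\<close>.\<close>
    moreover have "power_sum_germs x k c e (y - axis (pos (k, l)) a) (z - axis (pos (k, l)) a) =
        (coord z k l - a) ^ e + s e z" if l: "l \<in> J" for l z
    proof -
      have lk: "l \<in> {1..m k}" and yl: "coord y k l = coord y k j" using J(3)[OF l] by auto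
      let ?t = "\<lambda>i. if coord y k i = c then coord z k i ^ e else 0"
      have "power_sum_germs x k c e (y - axis (pos (k, l)) a) (z - axis (pos (k, l)) a) =
          (\<Sum>i\<in>{1..m k}. if i = l then (coord z k l - a) ^ e else ?t i)"
        unfolding power_sum_germs_def x_def
        using shift_in_orbit[OF k lk yl, of a] k(1) lk yl
        by (auto simp: coord_axis c_def intro!: sum.cong)
      also have "\<dots> = (coord z k l - a) ^ e + (\<Sum>i\<in>{1..m k} - {l}. ?t i)"
        using lk by (subst sum.remove[of _ l]) auto
      also have "(\<Sum>i\<in>{1..m k} - {l}. ?t i) = s e z"
        unfolding s_def using lk yl False by (subst (2) sum.remove[of _ l]) (auto simp: c_def)
      finally show ?thesis .
    qed
    ultimately show ?thesis by (simp add: sum.reindex[OF inj] B_def)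
  qed
  \<comment> \<open>Exponent \<open>0\<close>: every contributing test germ is the constant \<open>1 + r\<close>, which is not zero.\<close>
  have total: "regular_germ S y (\<lambda>z. \<Sum>l\<in>J. B l z)"
  proof (rule regular_germ_cmult_cancel)
    define r where "r = card {i\<in>{1..m k}. coord y k i = c}"
    have "s 0 z = of_nat r" for z by (simp add: s_def r_def sum.inter_filter[symmetric])
    thus "regular_germ S y (\<lambda>z. of_nat (Suc r) * (\<Sum>l\<in>J. B l z))"
      using moment[of 0] by (simp add: sum_distrib_right[symmetric] mult.commute)
    show "of_nat (Suc r) \<noteq> (0 :: complex)" by (simp only: of_nat_eq_0_iff)
  qed
  have s_poly: "poly_fun (s e)" for e
  proof -
    have "poly_fun (\<lambda>z. if coord y k i = c then coord z k i ^ e else 0)" for i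
      by (cases "coord y k i = c") (auto intro: poly_fun_power poly_fun.intros)
    thus ?thesis unfolding s_def by (intro poly_fun_sum)
  qed
  have "regular_germ S y
      (\<lambda>z. (\<Sum>l\<in>J. B l z * ((coord z k l - a) ^ e + s e z)) - s e z * (\<Sum>l\<in>J. B l z))" for e
    by (rule regular_germ_diff[OF moment regular_germ_mult[OF regular_germ_poly_fun[OF s_poly] total]])
  hence "regular_germ S y (\<lambda>z. \<Sum>l\<in>J. B l z * (coord z k l - a) ^ e)" for e
    by (simp add: sum_distrib_left sum_subtractf[symmetric] algebra_simps)
  \<comment> \<open>At each node other than the one of index \<open>j\<close> one factor vanishes, so only \<open>B j\<close> survives.\<close>
  hence "regular_germ S y (\<lambda>z. \<Sum>l\<in>J. B l z * (coord z k l - a) ^ 0 *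
      (\<Prod>i\<in>J - {j}. (coord z k l - a) - (coord z k i - a)))"
    by (rule regular_germ_node_polynomial)
       (use J(1) in \<open>auto intro!: poly_fun_diff poly_fun.intros\<close>)
  moreover have "(\<Sum>l\<in>J. B l z * (coord z k l - a) ^ 0 *
      (\<Prod>i\<in>J - {j}. (coord z k l - a) - (coord z k i - a))) =
      B j z * (\<Prod>i\<in>J - {j}. coord z k j - coord z k i)" for z
  proof -
    have "(\<Prod>i\<in>J - {j}. coord z k l - coord z k i) = 0" if "l \<in> J - {j}" for l
      by (rule prod_zero) (use that J(1) in auto)
    hence "(\<Sum>l\<in>J - {j}. B l z * (\<Prod>i\<in>J - {j}. coord z k l - coord z k i)) = 0"
      by (intro sum.neutral ballI) (simp only: mult_zero_right)
    thus ?thesis using J(1,2) by (subst sum.remove[of _ j]) simp_all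
  qed
  moreover have "J - {j} = {l\<in>{1..m k} - {j}. coord y k l = coord y k j}" by (auto simp: J_def)
  ultimately show ?thesis by (simp add: B_def)
qed

text \<open>
  \<open>G\<close> permutes the vectors \<open>a \<delta>\<^sup>k\<^sup>i\<close> of a block, so the orbit of \<open>\<xi>\<^sub>k\<^sup>a\<close> consists of such vectors.
\<close>
lemma act_eq_xi_imp_axis:
  assumes g: "g \<in> carrier G" and k: "k \<in> {1..n}" "1 \<le> m k"
    and eq: "act n m pos g \<eta> = xi pos k a"
  shows "\<exists>i\<in>{1..m k}. \<eta> = axis (pos (k, i)) a"
proof
  note p = permutes_G[OF g k(1)]
  define i where "i = Hilbert_Choice.inv (g k) 1"
  show i: "i \<in> {1..m k}"
    using permutes_in_image[OF permutes_inv[OF p], of 1] k(2) by (simp add: i_def)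
  show "\<eta> = axis (pos (k, i)) a"
  proof (rule vec_eq_coord)
    fix k' i' assume k': "k' \<in> {1..n}" "i' \<in> {1..m k'}"
    have "g k' i' \<in> {1..m k'}"
      using permutes_in_image[OF permutes_G[OF g k'(1)], of i'] k'(2) by blast
    moreover have "g k i' = 1 \<longleftrightarrow> i' = i"
      unfolding i_def using permutes_inverses[OF p] by metis
    moreover have "coord \<eta> k' i' = coord (xi pos k a) k' (g k' i')"
      using coord_act_image[OF g k', of \<eta>] eq by simp
    ultimately show "coord \<eta> k' i' = coord (axis (pos (k, i)) a) k' i'"
      using k k' i by (auto simp: xi_def coord_axis)
  qed
qed

lemma symmetrized_term_support:
  assumes m: "\<And>k. k \<in> {1..n} \<Longrightarrow> m k \<ge> 1" and i: "\<And>s. s \<in> {1..p} \<Longrightarrow> i s \<in> {1..n}"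
    and \<eta>: "\<nexists>k l b. k \<in> {1..n} \<and> l \<in> {1..m k} \<and> \<eta> = axis (pos (k, l)) b"
  shows "(\<Sum>s=1..p. \<Sum>g\<in>carrier G.
    act_skew n m pos g (skew_term (f s) (xi pos (i s) (a s))) \<eta> z) = 0"
proof (intro sum.neutral ballI)
  fix s g assume s: "s \<in> {1..p}" and g: "g \<in> carrier G"
  have "act n m pos (inv\<^bsub>G\<^esub> g) \<eta> \<noteq> xi pos (i s) (a s)"
    using act_eq_xi_imp_axis[OF group.inv_closed[OF group_G g] i[OF s] m[OF i[OF s]]] \<eta> i[OF s]
    by blast
  thus "act_skew n m pos g (skew_term (f s) (xi pos (i s) (a s))) \<eta> z = 0"
    by (simp add: act_skew_def skew_term_def act_fun_def)
qed

text \<open>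
  At each point \<open>y\<close> the pole bound concerns the product over the mirrors through \<open>y\<close> that involve
  the position \<open>j\<close>; this product depends on \<open>y\<close>, but \<open>d\<close> is a multiple of all of them.
\<close>
lemma skew_regular_sign:
  assumes forms: "\<And>H. H \<in> refl_hyperplanes n m pos \<Longrightarrow> is_hyperplane_form H (\<gamma> H)"
    and A: "A \<in> skew_ring S" and pres: "preserves_invariant_germs S n m pos A"
    and supp: "\<And>\<eta>. (\<nexists>k i b. k \<in> {1..n} \<and> i \<in> {1..m k} \<and> \<eta> = axis (pos (k, i)) b) \<Longrightarrow>
      mero_eq (A \<eta>) (\<lambda>_. 0)"
  shows "skew_regular S (d_char n m pos \<gamma> sign_char) A"
  unfolding skew_regular_def
proof
  fix \<xi>
  let ?d = "d_char n m pos \<gamma> sign_char"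
  have d: "poly_fun ?d" using forms by (rule poly_fun_d_char)
  have fin: "finite (skew_support A)" using A by (simp add: skew_ring_def)
  show "is_regular S (\<lambda>z. ?d z * A \<xi> z)"
  proof (rule is_regular_if_regular_germs)
    assume "S = Algebraic"
    thus "(\<lambda>z. ?d z * A \<xi> z) \<in> mero Algebraic"
      using A by (intro mero_Algebraic_mult[OF d]) (auto simp only: skew_ring_def)
  next
    fix y
    show "regular_germ S y (\<lambda>z. ?d z * A \<xi> z)"
    proof (cases "\<exists>k j a. k \<in> {1..n} \<and> j \<in> {1..m k} \<and> \<xi> = axis (pos (k, j)) a")
      case True
      then obtain k j a where k: "k \<in> {1..n}" "j \<in> {1..m k}" and \<xi>: "\<xi> = axis (pos (k, j)) a"
        by blast
      let ?J = "{l\<in>{1..m k} - {j}. coord y k l = coord y k j}"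
      obtain R where R: "poly_fun R"
        "\<And>z. ?d z = R z * (\<Prod>l\<in>?J. coord z k j - coord z k l)"
        using d_char_sign_factor[OF forms k, of ?J] by blast
      have "regular_germ S y (\<lambda>z. A \<xi> z * (\<Prod>l\<in>?J. coord z k j - coord z k l))"
        unfolding \<xi> using supp by (intro regular_germ_coefficient[OF pres fin _ k])
          (simp add: mero_eq_def)
      from regular_germ_mult[OF regular_germ_poly_fun[OF R(1)] this] show ?thesis
        by (simp add: R(2) mult_ac)
    next
      case False
      hence "germ_eq y (A \<xi>) (\<lambda>_. 0)" using supp by (simp add: mero_eq_def)
      from germ_eq_mult[OF germ_eq_refl[of y ?d] this] show ?thesis
        using regular_germ_cong regular_germ_poly_fun[OF poly_fun.const] by force
    qed
  qed
qed

end

theorem theorem20: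
  fixes S :: geometry
    and n :: nat and m :: "nat \<Rightarrow> nat" and pos :: "nat \<times> nat \<Rightarrow> 'i::finite"
    and \<gamma> :: "(complex ^ 'i) set \<Rightarrow> complex ^ 'i \<Rightarrow> complex"
    and p :: nat and f :: "nat \<Rightarrow> complex ^ 'i \<Rightarrow> complex"
    and a :: "nat \<Rightarrow> complex" and i :: "nat \<Rightarrow> nat"
    and A :: "'i skew"
  assumes "n \<ge> 2"
    and "\<And>k. k \<in> {1..n} \<Longrightarrow> m k \<ge> 1"
    and "bij_betw pos (positions n m) UNIV"
    and "\<And>H. H \<in> refl_hyperplanes n m pos \<Longrightarrow> is_hyperplane_form H (\<gamma> H)"
    and "\<And>s. s \<in> {1..p} \<Longrightarrow> f s \<in> mero S"
    and "\<And>s. s \<in> {1..p} \<Longrightarrow> i s \<in> {1..n}"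
    and "A \<in> skew_invariants S n m pos"
    and "skew_eq A (\<lambda>\<eta> z. \<Sum>s=1..p. \<Sum>g\<in>carrier (perm_group n m).
           act_skew n m pos g (skew_term (f s) (xi pos (i s) (a s))) \<eta> z)"
    and "preserves_invariant_germs S n m pos A"
  shows "galois_order_generator S n m pos \<gamma> A"
proof -
  interpret block_permutations n m pos by unfold_locales (rule assms(3))
  have supp: "mero_eq (A \<eta>) (\<lambda>_. 0)"
    if "\<nexists>k l b. k \<in> {1..n} \<and> l \<in> {1..m k} \<and> \<eta> = axis (pos (k, l)) b" for \<eta>
  proof -
    have "(\<lambda>z. \<Sum>s=1..p. \<Sum>g\<in>carrier (perm_group n m).
        act_skew n m pos g (skew_term (f s) (xi pos (i s) (a s))) \<eta> z) = (\<lambda>_. 0)"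
      by (rule ext) (rule symmetrized_term_support[where i = i, OF _ _ that], rule assms(2), assumption,
          rule assms(6), assumption)
    thus ?thesis using assms(8)[unfolded skew_eq_def, rule_format, of \<eta>] by simp
  qed
  have "A \<in> skew_ring S" using assms(7) by (simp add: skew_invariants_def)
  hence "skew_regular S (d_char n m pos \<gamma> sign_char) A"
    using skew_regular_sign[OF assms(4) _ assms(9) supp] by blast
  thus ?thesis unfolding galois_order_generator_def using assms(7) sign_char_hom by blast
qed

end
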